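(* For every non-empty, convex, closed, bounded set $\mathbb{T}\subset\mathbb{R}^2$ there exists a convex Peano curve filling $\mathbb{T}$, i.e. a continuous surjection $f\colon[0,1]\to\mathbb{T}$ such that the image $f(I)$ of every subinterval $I\subset[0,1]$ (closed or not) is a convex set. Moreover, if $\mathbb{T}$ has non-empty interior, then $f$ can be chosen so that, additionally, for every subinterval $I\subset[0,1]$ not degenerate to a point, the convex set $f(I)$ has non-empty interior.
   Context: A convex Peano curve filling a set $\mathbb{T}\subset\mathbb{R}^2$ is a continuous surjection $f\colon[0,1]\to\mathbb{T}$ such that the image of any subinterval of $[0,1]$ (closed or not) is a convex set. *)

theory Defs
  imports "HOL-Analysis.Analysis"
begin

(* For sets of reals, is_interval means order-convexity, so I ranges over all open, closed and
   half-open subintervals of the unit interval (and the harmless cases of points and the empty set). *)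
definition convex_Peano_curve :: "(real ^ 2) set \<Rightarrow> (real \<Rightarrow> real ^ 2) \<Rightarrow> bool" where
  "convex_Peano_curve T f \<longleftrightarrow>
     continuous_on {0..1} f \<and> f ` {0..1} = T \<and>
     (\<forall>I. is_interval I \<and> I \<subseteq> {0..1} \<longrightarrow> convex (f ` I))"

end

theory Submission
  imports Defs
begin

text \<open>
  The curve is a limit of finite lists of tiles: closed convex subsets of \<open>T\<close> such that the
  union of any block of consecutive tiles is convex and the union of all of them is \<open>T\<close>.  Such a list
  is refined repeatedly until its tiles have small diameter; since a refinement may grow the tiles slightly,
  block unions of later lists can be rounder than those of earlier ones, and this freedom is indispensable:
  a flat edge in the interior of \<open>T\<close> can never be crossed by small tiles.

  A refinement has three ingredients, all of which preserve convexity of block unions.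
  First, replace every tile by the intersection of \<open>T\<close> with a strictly convex neighbourhood of it; the
  neighbourhood is chosen such that its formation commutes with unions, so that every block union becomes
  strictly convex inside \<open>T\<close>.
  Secondly, insert intermediate tiles between consecutive ones such that consecutive tiles
  differ only inside a small ball.  This is possible because adding a nearby point to a strictly convex set
  and taking the convex hull changes the set only near that point.
  Thirdly, cut the tiles into parallel strips and walk through them, changing from one tile to the next only
  while in a strip containing the ball where they differ.  Then every block union is the intersection of a
  block union of the old list with a strip.  Doing this for all coordinate directions makes the tiles small.
\<close>

section \<open>Lists of sets with convex blocks\<close>

text \<open>Growing a strictly convex set point by point controls what is added, not what is
  dropped. One pass of insertions therefore leads from a tile \<open>X\<close> to the next tile
  \<open>A\<close> by an uncontrolled jump up to \<open>A \<union> X\<close>, followed by a descent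
  to \<open>A\<close> in which small pieces of \<open>X\<close> are removed. In the reversed list
  the growing steps are these small ones, so a second pass run backwards makes all steps small.
  Reaching diameter \<open>\<delta>\<close> from diameter \<open>D\<close> displaces points by at
  most \<open>C * D\<close>, where \<open>C\<close> does not depend on \<open>\<delta>\<close>:
  cutting displaces nothing, insertion displaces by a multiple of the current diameters, and the
  swelling radii are at choice. Halving the diameter bound at each stage thus makes the
  displacements summable, and the curve is a uniform limit. Convexity of the image of
  \<open>{s..t}\<close> passes to the limit from the block unions because this image is closed; any
  other interval contains the closed interval between two of its points. For interior points every
  stage ends with a swelling, so that each tile contains a neighbourhood in \<open>T\<close> of one
  of its points. The curve covers the whole tile during the time allotted to it, since the pieces of
  a tile cover it.\<close>

definition prefix_unions :: "'a set list \<Rightarrow> 'a set set" where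
  "prefix_unions xs = {\<Union> (set us) |us ws. xs = us @ ws}"

definition convex_blocks :: "'a::real_vector set list \<Rightarrow> bool" where
  "convex_blocks xs \<longleftrightarrow> (\<forall>us vs ws. xs = us @ vs @ ws \<longrightarrow> convex (\<Union> (set vs)))"

lemma prefix_unions_Nil [simp]: "prefix_unions [] = {{}}"
  by (auto simp: prefix_unions_def)

lemma prefix_unions_Cons: "prefix_unions (x # xs) = insert {} ((\<union>) x ` prefix_unions xs)"
proof -
  have "s \<in> insert {} ((\<union>) x ` prefix_unions xs)" if "s \<in> prefix_unions (x # xs)" for s
  proof -
    from that obtain us ws where "s = \<Union> (set us)" "x # xs = us @ ws"
      by (auto simp: prefix_unions_def)
    then show ?thesis
      by (cases us) (auto simp: prefix_unions_def)
  qed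
  moreover have "x \<union> s \<in> prefix_unions (x # xs)" if s: "s \<in> prefix_unions xs" for s
  proof -
    from s obtain us ws where "s = \<Union> (set us)" "xs = us @ ws" by (auto simp: prefix_unions_def)
    then have "x \<union> s = \<Union> (set (x # us))" "x # xs = (x # us) @ ws" by auto
    then show ?thesis unfolding prefix_unions_def by blast
  qed
  moreover have "{} \<in> prefix_unions (x # xs)"
    unfolding prefix_unions_def by (rule CollectI, rule exI[of _ "[]"]) auto
  ultimately show ?thesis by blast
qed

lemma empty_in_prefix_unions [simp]: "{} \<in> prefix_unions xs"
  by (cases xs) (auto simp: prefix_unions_Cons)

lemma convex_blocks_Nil [simp]: "convex_blocks []"
  by (simp add: convex_blocks_def)

text \<open>A block of \<open>x # xs\<close> either starts at \<open>x\<close> or lies in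
  \<open>xs\<close>. The inductive constructions below build lists from the back by this recursion,
  which is why they keep track of the prefix unions of the part already built.\<close>

lemma convex_blocks_Cons:
  "convex_blocks (x # xs) \<longleftrightarrow> (\<forall>s \<in> prefix_unions (x # xs). convex s) \<and> convex_blocks xs"
proof
  assume *: "convex_blocks (x # xs)"
  have "convex_blocks xs"
    unfolding convex_blocks_def
  proof (intro allI impI)
    fix us vs ws assume "xs = us @ vs @ ws"
    then have "x # xs = (x # us) @ vs @ ws" by simp
    with * show "convex (\<Union> (set vs))" unfolding convex_blocks_def by blast
  qed
  moreover have "convex s" if s: "s \<in> prefix_unions (x # xs)" for s
  proof -
    from s obtain us ws where "s = \<Union> (set us)" "x # xs = us @ ws"
      by (auto simp: prefix_unions_def)
    with * show ?thesis unfolding convex_blocks_def by (metis append_Nil)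
  qed
  ultimately show "(\<forall>s \<in> prefix_unions (x # xs). convex s) \<and> convex_blocks xs" by blast
next
  assume *: "(\<forall>s \<in> prefix_unions (x # xs). convex s) \<and> convex_blocks xs"
  show "convex_blocks (x # xs)"
    unfolding convex_blocks_def
  proof (intro allI impI)
    fix us vs ws assume eq: "x # xs = us @ vs @ ws"
    show "convex (\<Union> (set vs))"
    proof (cases us)
      case Nil
      with eq have "\<Union> (set vs) \<in> prefix_unions (x # xs)"
        by (auto simp: prefix_unions_def)
      with * show ?thesis by blast
    next
      case (Cons y us')
      with eq have "xs = us' @ vs @ ws" by simp
      with * show ?thesis unfolding convex_blocks_def by blast
    qed
  qed
qed

lemma convex_prefix_unions: "convex_blocks xs \<Longrightarrow> s \<in> prefix_unions xs \<Longrightarrow> convex s"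
  by (cases xs) (auto simp: convex_blocks_Cons)

lemma convex_blocks_convex: "convex_blocks xs \<Longrightarrow> x \<in> set xs \<Longrightarrow> convex x"
proof -
  assume *: "convex_blocks xs" "x \<in> set xs"
  then obtain us ws where "xs = us @ [x] @ ws" by (metis append_Cons append_Nil split_list)
  with * have "convex (\<Union> (set [x]))" unfolding convex_blocks_def by blast
  then show "convex x" by simp
qed

lemma convex_blocks_rev: "convex_blocks xs \<Longrightarrow> convex_blocks (rev xs)"
  unfolding convex_blocks_def
proof (intro allI impI)
  fix us vs ws
  assume *: "\<forall>us vs ws. xs = us @ vs @ ws \<longrightarrow> convex (\<Union> (set vs))" "rev xs = us @ vs @ ws"
  then have "xs = rev ws @ rev vs @ rev us"
    by (metis append.assoc rev_append rev_rev_ident)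
  with * have "convex (\<Union> (set (rev vs)))" by blast
  then show "convex (\<Union> (set vs))" by simp
qed

lemma convex_blocks_map:
  assumes "convex_blocks xs"
    and "\<And>ys. ys \<noteq> [] \<Longrightarrow> set ys \<subseteq> set xs \<Longrightarrow> convex (\<Union> (set ys)) \<Longrightarrow> convex (\<Union> (set (map f ys)))"
  shows "convex_blocks (map f xs)"
  unfolding convex_blocks_def
proof (intro allI impI)
  fix us vs ws assume "map f xs = us @ vs @ ws"
  then obtain us' vs' ws' where *: "xs = us' @ vs' @ ws'" "map f vs' = vs"
    by (metis append_eq_map_conv)
  then have "convex (\<Union> (set vs'))" using assms(1) unfolding convex_blocks_def by blast
  then show "convex (\<Union> (set vs))"
    using assms(2)[of vs'] * by (cases "vs' = []") auto
qed

section \<open>Changes of a list that do not affect its blocks\<close>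

definition block_equiv :: "'a::real_vector set list \<Rightarrow> 'a set list \<Rightarrow> bool" where
  "block_equiv xs ys \<longleftrightarrow>
     prefix_unions xs = prefix_unions ys \<and> convex_blocks xs = convex_blocks ys"

lemma block_equiv_refl [simp]: "block_equiv xs xs"
  by (simp add: block_equiv_def)

lemma block_equiv_trans [trans]: "block_equiv xs ys \<Longrightarrow> block_equiv ys zs \<Longrightarrow> block_equiv xs zs"
  by (simp add: block_equiv_def)

text \<open>Prepending \<open>x\<close> creates new blocks, namely \<open>x\<close> united with the
  prefix unions of the rest. Hence \<open>block_equiv\<close> asks for equal prefix unions as well:
  agreement of \<open>convex_blocks\<close> alone would not survive prepending.\<close>

lemma block_equiv_Cons: "block_equiv xs ys \<Longrightarrow> block_equiv (x # xs) (x # ys)"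
  by (auto simp: block_equiv_def convex_blocks_Cons prefix_unions_Cons)

lemma block_equiv_append: "block_equiv xs ys \<Longrightarrow> block_equiv (us @ xs) (us @ ys)"
  by (induction us) (auto intro: block_equiv_Cons)

lemma block_equiv_empty: "block_equiv ({} # xs) xs"
  by (auto simp: block_equiv_def convex_blocks_Cons prefix_unions_Cons convex_prefix_unions)

lemma block_equiv_double: "block_equiv (x # x # xs) (x # xs)"
proof -
  have "prefix_unions (x # x # xs) = prefix_unions (x # xs)"
    unfolding prefix_unions_Cons using empty_in_prefix_unions[of xs]
    by (auto simp: image_iff)
  then show ?thesis
    by (auto simp: block_equiv_def convex_blocks_Cons)
qed

lemma block_equiv_replicate_Cons: "block_equiv (x # replicate n x @ xs) (x # xs)"
  by (induction n) (auto intro: block_equiv_trans[OF block_equiv_double])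

lemma block_equiv_pad:
  assumes "ys \<noteq> []"
  shows "block_equiv (ys @ replicate n (last ys) @ xs) (ys @ xs)"
proof -
  obtain us x where ys: "ys = us @ [x]" using assms by (metis rev_exhaust)
  show ?thesis
    using block_equiv_append[OF block_equiv_replicate_Cons, of us x n xs] by (simp add: ys)
qed

lemma block_equiv_filter: "block_equiv (filter (\<lambda>x. x \<noteq> {}) xs) xs"
proof (induction xs)
  case (Cons x xs)
  show ?case
  proof (cases "x = {}")
    case True
    have "block_equiv xs (x # xs)"
      using block_equiv_empty[of xs] True by (simp add: block_equiv_def)
    with Cons.IH True show ?thesis by (simp add: block_equiv_trans)
  next
    case False
    then show ?thesis using block_equiv_Cons[OF Cons.IH, of x] by simp
  qed
qed simp

lemma block_equiv_constant:
  assumes "set rs = {x}"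
  shows "block_equiv (rs @ xs) (x # xs)"
proof -
  have "rs = replicate (length rs) x"
    using assms by (metis replicate_eqI singletonD)
  moreover have "length rs \<noteq> 0" using assms by auto
  ultimately obtain n where "rs = x # replicate n x"
    by (metis length_0_conv list.size(3) not0_implies_Suc replicate_Suc)
  then show ?thesis using block_equiv_replicate_Cons[of x n xs] by simp
qed

lemma block_equiv_concat_constant:
  assumes "list_all2 (\<lambda>x rs. set rs = {x}) xs rss"
  shows "block_equiv (concat rss) xs"
  using assms
proof (induction rule: list_all2_induct)
  case (Cons x xs r rss)
  have "block_equiv (r @ concat rss) (x # concat rss)"
    using Cons.hyps(1) by (rule block_equiv_constant)
  also have "block_equiv (x # concat rss) (x # xs)"
    using Cons.IH by (rule block_equiv_Cons)
  finally show ?case by simp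
qed simp

lemma block_equiv_concat_pad:
  assumes "\<forall>ys \<in> set yss. ys \<noteq> []"
  shows "block_equiv (concat (map (\<lambda>ys. ys @ replicate (M - length ys) (last ys)) yss)) (concat yss)"
  using assms
proof (induction yss)
  case (Cons ys yss)
  let ?c = "concat (map (\<lambda>ys. ys @ replicate (M - length ys) (last ys)) yss)"
  have "block_equiv (ys @ replicate (M - length ys) (last ys) @ ?c) (ys @ ?c)"
    using Cons.prems by (intro block_equiv_pad) auto
  also have "block_equiv (ys @ ?c) (ys @ concat yss)"
    using Cons by (intro block_equiv_append) auto
  finally show ?case by simp
qed auto

section \<open>Subdivision with bounded displacement\<close>

definition near_cover :: "real \<Rightarrow> 'a::metric_space set \<Rightarrow> 'a set list \<Rightarrow> bool" where
  "near_cover r X ys \<longleftrightarrow> ys \<noteq> [] \<and> X \<subseteq> \<Union> (set ys) \<and>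
     (\<forall>Y \<in> set ys. \<forall>y \<in> Y. \<exists>x \<in> X. dist x y \<le> r)"

text \<open>The pieces of a tile may leave it by up to \<open>r\<close>, since swelling enlarges
  tiles and inserted tiles reach into their neighbours. They still have to cover it, so that the
  final curve misses no point.\<close>

definition subdivides :: "real \<Rightarrow> 'a::metric_space set list \<Rightarrow> 'a set list \<Rightarrow> bool" where
  "subdivides r xs ys \<longleftrightarrow> (\<exists>yss. list_all2 (near_cover r) xs yss \<and> ys = concat yss)"

lemma near_cover_concat:
  assumes "near_cover r X ys" "list_all2 (near_cover s) ys zss"
  shows "near_cover (r + s) X (concat zss)"
proof -
  have X: "X \<subseteq> \<Union> (set ys)" "ys \<noteq> []" using assms(1) by (auto simp: near_cover_def)
  have cover: "\<Union> (set ys) \<subseteq> \<Union> (set (concat zss))"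
    using assms(2) by (induction rule: list_all2_induct) (auto simp: near_cover_def)
  have ex: "\<exists>Y \<in> set ys. near_cover s Y zs" if "zs \<in> set zss" for zs
    using assms(2) that by (metis in_set_conv_nth list_all2_conv_all_nth)
  have "concat zss \<noteq> []"
  proof -
    obtain Y ys' where "ys = Y # ys'" using X(2) by (cases ys) auto
    with assms(2) obtain zs zss' where "zss = zs # zss'" "near_cover s Y zs"
      by (auto simp: list_all2_Cons1)
    then show ?thesis by (simp add: near_cover_def)
  qed
  moreover have "\<exists>x \<in> X. dist x z \<le> r + s" if "Z \<in> set (concat zss)" "z \<in> Z" for Z z
  proof -
    from that obtain zs where "zs \<in> set zss" "Z \<in> set zs" by auto
    with ex obtain Y where Y: "Y \<in> set ys" "near_cover s Y zs" by blast
    with \<open>Z \<in> set zs\<close> that obtain y where y: "y \<in> Y" "dist y z \<le> s"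
      unfolding near_cover_def by blast
    with Y assms(1) obtain x where "x \<in> X" "dist x y \<le> r" unfolding near_cover_def by blast
    with y have "dist x z \<le> r + s" using dist_triangle[of x z y] by linarith
    with \<open>x \<in> X\<close> show ?thesis by blast
  qed
  ultimately show ?thesis using X cover by (auto simp: near_cover_def)
qed

lemma subdivides_trans:
  assumes "subdivides r xs ys" "subdivides s ys zs"
  shows "subdivides (r + s) xs zs"
proof -
  obtain yss where yss: "list_all2 (near_cover r) xs yss" "ys = concat yss"
    using assms(1) by (auto simp: subdivides_def)
  obtain zss where zss: "list_all2 (near_cover s) (concat yss) zss" "zs = concat zss"
    using assms(2) yss by (auto simp: subdivides_def)
  have "\<exists>wss. list_all2 (near_cover (r + s)) xs wss \<and> concat wss = concat zss"
    using yss(1) zss(1)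
  proof (induction arbitrary: zss rule: list_all2_induct)
    case (Cons x xs ys yss)
    from Cons.prems obtain us vs where uv: "zss = us @ vs" "list_all2 (near_cover s) ys us"
      "list_all2 (near_cover s) (concat yss) vs"
      by (auto simp: list_all2_append1)
    from Cons.IH[OF uv(3)] obtain wss
      where "list_all2 (near_cover (r + s)) xs wss" "concat wss = concat vs" by blast
    moreover have "near_cover (r + s) x (concat us)" using near_cover_concat Cons.hyps(1) uv(2) by blast
    ultimately show ?case using uv(1) by (intro exI[of _ "concat us # wss"]) auto
  qed auto
  then show ?thesis unfolding subdivides_def zss(2) by metis
qed

lemma subdivides_rev:
  assumes "subdivides r xs ys" shows "subdivides r (rev xs) (rev ys)"
proof -
  obtain yss where yss: "list_all2 (near_cover r) xs yss" "ys = concat yss"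
    using assms(1) by (auto simp: subdivides_def)
  have "list_all2 (\<lambda>x ys. near_cover r x (rev ys)) xs yss"
    using yss(1) by (rule list_all2_mono) (auto simp: near_cover_def)
  then have "list_all2 (near_cover r) (rev xs) (map rev (rev yss))"
    by (simp add: list.rel_map(2))
  then show ?thesis unfolding subdivides_def yss(2) rev_concat by blast
qed

lemma subdivides_mono: "subdivides r xs ys \<Longrightarrow> r \<le> s \<Longrightarrow> subdivides s xs ys"
  unfolding subdivides_def
  by (elim exE conjE, rule exI, rule conjI, erule list_all2_mono)
     (unfold near_cover_def, blast intro: order_trans, simp)

lemma subdivides_map:
  assumes "\<And>x. x \<in> set xs \<Longrightarrow> x \<subseteq> f x \<and> (\<forall>y \<in> f x. \<exists>z \<in> x. dist z y \<le> r)"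
  shows "subdivides r xs (map f xs)"
proof -
  have "list_all2 (near_cover r) xs (map (\<lambda>x. [f x]) xs)"
    using assms by (induction xs) (auto simp: near_cover_def)
  moreover have "map f xs = concat (map (\<lambda>x. [f x]) xs)" by (induction xs) auto
  ultimately show ?thesis unfolding subdivides_def by blast
qed

section \<open>Strictly convex neighbourhoods\<close>

text \<open>
  Sublevel sets of the energy form the neighbourhood: the distance term makes it commute with unions, and
  the quadratic term makes it strictly convex.
\<close>

definition energy :: "real \<Rightarrow> 'a::euclidean_space set \<Rightarrow> 'a \<Rightarrow> real" where
  "energy a X x = (infdist x X)\<^sup>2 + a * (norm x)\<^sup>2"

definition swell :: "real \<Rightarrow> real \<Rightarrow> 'a::euclidean_space set \<Rightarrow> 'a set" where
  "swell a \<rho> X = {x. energy a X x \<le> \<rho>\<^sup>2}"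

lemma infdist_convex_combination:
  fixes X :: "'a::euclidean_space set"
  assumes "convex X" "closed X" "X \<noteq> {}" "u \<ge> 0" "v \<ge> 0" "u + v = 1"
  shows "infdist (u *\<^sub>R x + v *\<^sub>R y) X \<le> u * infdist x X + v * infdist y X"
proof -
  obtain p where p: "p \<in> X" "infdist x X = dist x p"
    using infdist_attains_inf[OF assms(2,3)] by metis
  obtain q where q: "q \<in> X" "infdist y X = dist y q"
    using infdist_attains_inf[OF assms(2,3)] by metis
  have "u *\<^sub>R p + v *\<^sub>R q \<in> X" using assms p q by (simp add: convexD)
  then have "infdist (u *\<^sub>R x + v *\<^sub>R y) X \<le> dist (u *\<^sub>R x + v *\<^sub>R y) (u *\<^sub>R p + v *\<^sub>R q)"
    by (rule infdist_le)
  also have "\<dots> = norm (u *\<^sub>R (x - p) + v *\<^sub>R (y - q))"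
    by (simp add: dist_norm algebra_simps)
  also have "\<dots> \<le> u * norm (x - p) + v * norm (y - q)"
    using norm_triangle_ineq[of "u *\<^sub>R (x - p)" "v *\<^sub>R (y - q)"] assms by simp
  finally show ?thesis using p q by (simp add: dist_norm)
qed

text \<open>The squared distance is convex, being a monotone convex function of a convex one. The
  deficit comes from the norm term alone, for which the inequality is an identity.\<close>

lemma energy_strongly_convex:
  fixes X :: "'a::euclidean_space set"
  assumes "convex X" "closed X" "X \<noteq> {}" "a \<ge> 0" "u \<ge> 0" "v \<ge> 0" "u + v = 1"
  shows "energy a X (u *\<^sub>R x + v *\<^sub>R y)
    \<le> u * energy a X x + v * energy a X y - a * u * v * (norm (x - y))\<^sup>2"
proof -
  let ?s = "infdist x X" and ?t = "infdist y X"
  have v: "v = 1 - u" using assms by simp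
  have "(infdist (u *\<^sub>R x + v *\<^sub>R y) X)\<^sup>2 \<le> (u * ?s + v * ?t)\<^sup>2"
    using infdist_convex_combination[of X u v x y] assms infdist_nonneg by (intro power_mono) auto
  also have "\<dots> = u * ?s\<^sup>2 + v * ?t\<^sup>2 - u * v * (?s - ?t)\<^sup>2"
    unfolding v by (simp add: power2_eq_square algebra_simps)
  also have "\<dots> \<le> u * ?s\<^sup>2 + v * ?t\<^sup>2" using assms by simp
  finally have 1: "(infdist (u *\<^sub>R x + v *\<^sub>R y) X)\<^sup>2 \<le> u * ?s\<^sup>2 + v * ?t\<^sup>2" .
  have "(norm (u *\<^sub>R x + v *\<^sub>R y))\<^sup>2
      = u * (norm x)\<^sup>2 + v * (norm y)\<^sup>2 - u * v * (norm (x - y))\<^sup>2"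
    unfolding v power2_norm_eq_inner
    by (simp add: inner_add_left inner_add_right inner_diff_left inner_diff_right
        inner_commute algebra_simps)
  then have 2: "a * (norm (u *\<^sub>R x + v *\<^sub>R y))\<^sup>2
      = u * (a * (norm x)\<^sup>2) + v * (a * (norm y)\<^sup>2) - a * u * v * (norm (x - y))\<^sup>2"
    by (simp only:) (simp add: algebra_simps)
  show ?thesis unfolding energy_def 2 using 1 by (simp add: algebra_simps)
qed

lemma convex_energy_le:
  fixes X :: "'a::euclidean_space set"
  assumes "convex X" "closed X" "X \<noteq> {}" "a \<ge> 0"
  shows "convex {x. energy a X x \<le> c}"
proof (rule convexI)
  fix x y :: 'a and u v :: real
  assume *: "x \<in> {x. energy a X x \<le> c}" "y \<in> {x. energy a X x \<le> c}" "0 \<le> u" "0 \<le> v" "u + v = 1"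
  have "energy a X (u *\<^sub>R x + v *\<^sub>R y) \<le> u * energy a X x + v * energy a X y"
  proof -
    have "a * u * v * (norm (x - y))\<^sup>2 \<ge> 0" using * assms by simp
    then show ?thesis using energy_strongly_convex[of X a u v x y] * assms by linarith
  qed
  also have "\<dots> \<le> u * c + v * c" using * by (intro add_mono mult_left_mono) auto
  also have "\<dots> = c" using * by (simp flip: distrib_right)
  finally show "u *\<^sub>R x + v *\<^sub>R y \<in> {x. energy a X x \<le> c}" by simp
qed

lemma continuous_on_energy: "continuous_on S (energy a X)"
  unfolding energy_def by (intro continuous_intros)

lemma closed_swell: "closed (swell a \<rho> X)"
  unfolding swell_def using continuous_on_energy
  by (intro closed_Collect_le continuous_on_const) auto

lemma bounded_energy_le:
  assumes "a > 0" shows "bounded {x. energy a X x \<le> c}"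
proof -
  \<comment> \<open>Outside the unit ball \<open>norm x\<close> is at most its square, so this bound
    avoids a square root.\<close>
  have "norm x \<le> max 1 (c / a)" if "energy a X x \<le> c" for x
  proof (rule ccontr)
    assume *: "\<not> norm x \<le> max 1 (c / a)"
    then have "norm x * norm x \<ge> norm x * 1" by (intro mult_left_mono) auto
    then have "c / a < (norm x)\<^sup>2" using * by (simp add: power2_eq_square)
    then have "c < a * (norm x)\<^sup>2" using assms by (simp add: field_simps)
    then show False using that by (smt (verit) energy_def zero_le_power2)
  qed
  then show ?thesis unfolding bounded_iff by blast
qed

lemma compact_swell: "a > 0 \<Longrightarrow> compact (swell a \<rho> X)"
  using closed_swell[of a \<rho> X] bounded_energy_le[of a X "\<rho>\<^sup>2"]
  by (simp add: compact_eq_bounded_closed swell_def)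

lemma convex_swell:
  "convex X \<Longrightarrow> closed X \<Longrightarrow> X \<noteq> {} \<Longrightarrow> a \<ge> 0 \<Longrightarrow> convex (swell a \<rho> X)"
  unfolding swell_def by (rule convex_energy_le)

text \<open>The distance to a union is the smaller of the two distances, so the same holds for the
  energies, and a sublevel set of a minimum is a union.\<close>

lemma swell_Un:
  assumes "X \<noteq> {}" "Y \<noteq> {}"
  shows "swell a \<rho> (X \<union> Y) = swell a \<rho> X \<union> swell a \<rho> Y"
proof -
  have "(infdist x X)\<^sup>2 \<le> (infdist x Y)\<^sup>2" if "infdist x X \<le> infdist x Y" for x X and Y :: "'a set"
    using that infdist_nonneg by (rule power_mono)
  then show ?thesis
    unfolding swell_def energy_def infdist_Un_min[OF assms] min_def
    by (force simp: not_le dest: less_imp_le)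
qed

lemma infdist_swell:
  assumes "x \<in> swell a \<rho> X" "a \<ge> 0" "\<rho> \<ge> 0"
  shows "infdist x X \<le> \<rho>"
proof -
  have "0 \<le> a * (norm x)\<^sup>2" using assms by simp
  then have "(infdist x X)\<^sup>2 \<le> \<rho>\<^sup>2" using assms(1) unfolding swell_def energy_def by simp
  then show ?thesis using assms(3) by (rule power2_le_imp_le)
qed

text \<open>\<open>K\<close> is covered by finitely many small cubes whose vertices form the net.
  Mere density would not suffice, because the net points near \<open>w\<close> have to surround
  it.\<close>

lemma finite_hull_net:
  fixes K :: "'a::euclidean_space set"
  assumes "compact K" "\<kappa> > 0"
  obtains N where "finite N" "\<And>w. w \<in> K \<Longrightarrow> w \<in> convex hull (N \<inter> ball w \<kappa>)"
proof -
  \<comment> \<open>By the bound of the norm by the sum of coordinates, a cube of half side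
    \<open>d\<close> stays within \<open>\<kappa> / 2\<close> of its centre; a point and a vertex of
    one cube are then closer than \<open>\<kappa>\<close>.\<close>
  define d where "d = \<kappa> / (4 * real DIM('a))"
  have d: "d > 0" using assms by (simp add: d_def)
  define e :: 'a where "e = (\<Sum>i\<in>Basis. d *\<^sub>R i)"
  have ei: "e \<bullet> i = d" if "i \<in> Basis" for i
    using that by (simp add: e_def inner_sum_left inner_Basis if_distrib cong: if_cong)
  have small: "dist w x < \<kappa> / 2" if "x \<in> cbox (w - e) (w + e)" for w x
  proof -
    have "\<bar>(x - w) \<bullet> i\<bar> \<le> d" if i: "i \<in> Basis" for i
      using \<open>x \<in> _\<close> i ei[OF i] by (auto simp: mem_box inner_diff_left inner_add_left abs_le_iff
          dest!: bspec[OF _ i])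
    then have "(\<Sum>i\<in>Basis. \<bar>(x - w) \<bullet> i\<bar>) \<le> (\<Sum>i\<in>(Basis::'a set). d)"
      by (rule sum_mono)
    then have "norm (x - w) \<le> real DIM('a) * d"
      using norm_le_l1[of "x - w"] by simp
    also have "\<dots> < \<kappa> / 2" using assms by (simp add: d_def)
    finally show ?thesis by (simp add: dist_norm norm_minus_commute)
  qed
  have "\<forall>w. \<exists>S. finite S \<and> cbox (w - e) (w + e) = convex hull S"
    using cube_convex_hull[OF d] unfolding e_def by metis
  then obtain S where S: "\<And>w. finite (S w)" "\<And>w. cbox (w - e) (w + e) = convex hull (S w)"
    by metis
  have "w \<in> box (w - e) (w + e)" for w
    using d ei by (auto simp: mem_box inner_diff_left inner_add_left)
  then have "K \<subseteq> (\<Union>w\<in>K. box (w - e) (w + e))" by blast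
  then obtain F where F: "finite F" "F \<subseteq> K" "K \<subseteq> (\<Union>w\<in>F. box (w - e) (w + e))"
    using compactE_image[OF assms(1), of K "\<lambda>w. box (w - e) (w + e)"] by (metis open_box)
  show thesis
  proof
    show "finite (\<Union>w\<in>F. S w)" using F S by blast
    fix x assume "x \<in> K"
    then obtain w where w: "w \<in> F" "x \<in> box (w - e) (w + e)" using F by blast
    have xc: "x \<in> cbox (w - e) (w + e)" using w box_subset_cbox by blast
    have "y \<in> ball x \<kappa>" if "y \<in> S w" for y
    proof -
      have "y \<in> cbox (w - e) (w + e)" using that S(2) by (simp add: hull_inc)
      then have "dist w y < \<kappa> / 2" "dist w x < \<kappa> / 2" using small xc by auto
      then show ?thesis using dist_triangle2[of x y w] by (simp add: dist_commute)
    qed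
    then have "S w \<subseteq> (\<Union>w\<in>F. S w) \<inter> ball x \<kappa>" using w by blast
    moreover have "x \<in> convex hull (S w)" using xc S(2) by simp
    ultimately show "x \<in> convex hull ((\<Union>w\<in>F. S w) \<inter> ball x \<kappa>)"
      using hull_mono by blast
  qed
qed

text \<open>
  The sets \<open>Gs\<close> are the convex hulls of the first points of a fine net together with the neighbourhood,
  where the net is sorted by energy.  Adding a net point \<open>p\<close> to such a hull \<open>G\<close> only adds points of
  energy almost that of \<open>p\<close>, and the middle of a long segment from \<open>p\<close> into \<open>G\<close> has
  much lower energy by strong convexity, hence lies in \<open>G\<close>.
\<close>

lemma swell_local_growth:
  fixes P X :: "'a::euclidean_space set"
  assumes P: "convex P" "closed P" "P \<noteq> {}" and a: "a > 0" and X: "bounded X"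
    and ne: "swell a \<rho> P \<noteq> {}" and \<theta>: "\<theta> > 0"
  obtains Gs where "\<forall>G \<in> set Gs. closed G \<and> convex G"
    "successively (\<lambda>G H. G \<subseteq> H \<and> (\<exists>c. H - G \<subseteq> cball c \<theta>)) (swell a \<rho> P # Gs)"
    "X \<subseteq> last (swell a \<rho> P # Gs)"
proof -
  define U where "U = swell a \<rho> P"
  define g where "g = energy a P"
  \<comment> \<open>Strong convexity puts the midpoint of a segment of length
    \<open>\<theta>\<close> lower than its higher end by at least this amount.\<close>
  define \<eta> where "\<eta> = a * \<theta>\<^sup>2 / 4"
  have \<eta>: "\<eta> > 0" using a \<theta> by (simp add: \<eta>_def)
  have gconv: "convex {x. g x \<le> c}" for c
    unfolding g_def using P a by (intro convex_energy_le) auto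
  have gcont: "continuous_on S g" for S unfolding g_def by (rule continuous_on_energy)
  have U: "x \<in> U \<longleftrightarrow> g x \<le> \<rho>\<^sup>2" for x by (simp add: U_def swell_def g_def)
  have "compact (g ` closure X)"
    using X gcont by (intro compact_continuous_image) (auto simp: compact_closure)
  then obtain M' where M': "\<And>x. x \<in> X \<Longrightarrow> \<bar>g x\<bar> \<le> M'"
    using closure_subset by (force simp: bounded_iff dest!: compact_imp_bounded)
  \<comment> \<open>The margin \<open>\<eta>\<close> keeps the net points around a point of
    \<open>X\<close> below the level \<open>M\<close>, so that they are among the points to be
    added.\<close>
  define M where "M = M' + \<eta>"
  have XM: "g x \<le> M - \<eta>" if "x \<in> X" for x using M'[OF that] by (auto simp: M_def)
  define K where "K = {x. g x \<le> M}"
  have "bounded K" unfolding K_def g_def by (rule bounded_energy_le[OF a])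
  moreover have "closed K" unfolding K_def using gcont by (intro closed_Collect_le continuous_on_const)
  ultimately have "compact K" by (simp add: compact_eq_bounded_closed)
  have "\<exists>R. K \<subseteq> cball 0 R" using \<open>bounded K\<close> by (auto simp: bounded_iff subset_iff)
  then obtain R where R: "K \<subseteq> cball 0 R" by blast
  \<comment> \<open>The radius exceeds \<open>R\<close> by 1 because net points within
    \<open>\<kappa> \<le> 1\<close> of \<open>K\<close> may lie outside \<open>K\<close>.\<close>
  have "uniformly_continuous_on (cball 0 (R + 1)) g"
    using gcont by (intro compact_uniformly_continuous) auto
  then obtain \<kappa>' where \<kappa>': "\<kappa>' > 0"
    "\<And>x y. x \<in> cball 0 (R + 1) \<Longrightarrow> y \<in> cball 0 (R + 1) \<Longrightarrow> dist y x < \<kappa>' \<Longrightarrow> dist (g y) (g x) < \<eta>"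
    unfolding uniformly_continuous_on_def using \<eta> by metis
  define \<kappa> where "\<kappa> = min \<kappa>' 1"
  have "\<kappa> > 0" using \<kappa>' by (simp add: \<kappa>_def)
  obtain N where N: "finite N" "\<And>w. w \<in> K \<Longrightarrow> w \<in> convex hull (N \<inter> ball w \<kappa>)"
    using finite_hull_net[OF \<open>compact K\<close> \<open>\<kappa> > 0\<close>] by metis
  have near: "g x < g w + \<eta>" if "w \<in> K" "x \<in> ball w \<kappa>" for w x
  proof -
    have "norm w \<le> R" using that R by auto
    moreover have "dist w x < 1" "dist w x < \<kappa>'" using that by (auto simp: \<kappa>_def)
    moreover have "norm x \<le> norm w + dist w x"
      using norm_triangle_ineq2[of x w] by (simp add: dist_norm norm_minus_commute)
    ultimately have "dist (g x) (g w) < \<eta>" by (intro \<kappa>') (auto simp: dist_commute)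
    then show ?thesis by (simp add: dist_real_def)
  qed
  define S where "S = {x \<in> N. \<rho>\<^sup>2 < g x \<and> g x \<le> M}"
  obtain xs where xs: "set xs = S" "sorted (map g xs)"
  proof -
    have "finite S" using N by (simp add: S_def)
    then obtain ys where "set ys = S" using finite_list by blast
    then have "set (sort_key g ys) = S" "sorted (map g (sort_key g ys))" by auto
    then show ?thesis using that by blast
  qed
  define G where "G i = convex hull (U \<union> set (take i xs))" for i
  \<comment> \<open>All net points near such a \<open>w\<close> have energy below that of the next
    point \<open>xs ! i\<close>, or below \<open>M\<close> if none is left. By the sorting they lie
    in \<open>U\<close> or were added before, and \<open>w\<close> is in their hull.\<close>
  have net: "w \<in> G i" if "i \<le> length xs" "g w \<le> M - \<eta>" "i < length xs \<Longrightarrow> g w \<le> g (xs ! i) - \<eta>" for i w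
  proof -
    have "w \<in> K" using that \<eta> by (simp add: K_def)
    have "N \<inter> ball w \<kappa> \<subseteq> U \<union> set (take i xs)"
    proof
      fix x assume x: "x \<in> N \<inter> ball w \<kappa>"
      with near[OF \<open>w \<in> K\<close>] have gx: "g x < g w + \<eta>" by blast
      show "x \<in> U \<union> set (take i xs)"
      proof (cases "x \<in> U")
        case False
        then have "x \<in> S" using x gx that U by (auto simp: S_def)
        then obtain j where j: "j < length xs" "x = xs ! j" using xs by (metis in_set_conv_nth)
        have "j < i"
        proof (rule ccontr)
          assume "\<not> j < i"
          then have "i < length xs" "map g xs ! i \<le> map g xs ! j"
            using sorted_nth_mono[OF xs(2), of i j] j(1) by auto
          then show False using j gx that(3) by auto
        qed
        then show ?thesis using j by (auto simp: in_set_conv_nth)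
      qed auto
    qed
    then show ?thesis using N(2)[OF \<open>w \<in> K\<close>] hull_mono unfolding G_def by blast
  qed
  have G0: "G 0 = U" unfolding G_def U_def using convex_swell[of P a \<rho>] P a by (simp add: hull_same)
  have Gle: "G i \<subseteq> {x. g x \<le> g (xs ! i)}" if "i < length xs" for i
    unfolding G_def
  proof (rule hull_minimal, rule subsetI)
    fix x assume "x \<in> U \<union> set (take i xs)"
    then show "x \<in> {x. g x \<le> g (xs ! i)}"
    proof
      assume "x \<in> U"
      moreover have "xs ! i \<in> S" using that xs by auto
      ultimately show ?thesis by (auto simp: S_def U)
    next
      assume "x \<in> set (take i xs)"
      then obtain j where "j < i" "x = xs ! j" by (auto simp: in_set_conv_nth)
      then have "map g xs ! j \<le> map g xs ! i" using xs(2) that by (intro sorted_nth_mono) auto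
      then show ?thesis using \<open>j < i\<close> \<open>x = _\<close> that by simp
    qed
  qed (rule gconv)
  have step: "G i \<subseteq> G (Suc i) \<and> (\<exists>c. G (Suc i) - G i \<subseteq> cball c \<theta>)" if i: "i < length xs" for i
  proof (intro conjI exI subsetI)
    have "set (take i xs) \<subseteq> set (take (Suc i) xs)" by (rule set_take_subset_set_take) simp
    then have "G i \<subseteq> G (Suc i)" unfolding G_def by (intro hull_mono) blast
    then show "x \<in> G (Suc i)" if "x \<in> G i" for x using that by blast
    fix z assume z: "z \<in> G (Suc i) - G i"
    define p where "p = xs ! i"
    have ne': "U \<union> set (take i xs) \<noteq> {}" using ne by (simp add: U_def)
    have "U \<union> set (take (Suc i) xs) = insert p (U \<union> set (take i xs))"
      using i by (auto simp: p_def take_Suc_conv_app_nth)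
    then have "z \<in> convex hull (insert p (U \<union> set (take i xs)))" using z by (simp add: G_def)
    then have "\<exists>u\<ge>0. \<exists>v\<ge>0. \<exists>y. u + v = 1 \<and> y \<in> G i \<and> z = u *\<^sub>R p + v *\<^sub>R y"
      unfolding convex_hull_insert[OF ne'] G_def by (simp only: mem_Collect_eq)
    then obtain u v y where uv: "u \<ge> 0" "v \<ge> 0" "u + v = 1" and y: "y \<in> G i"
      and zeq: "z = u *\<^sub>R p + v *\<^sub>R y"
      by metis
    have "p \<in> S" using i xs(1) nth_mem unfolding p_def by blast
    then have gp: "g p \<le> M" by (simp add: S_def)
    have gy: "g y \<le> g p" using Gle[OF i] y by (auto simp: p_def)
    have out: "g w > g p - \<eta>" if "w \<notin> G i" for w
    proof (rule ccontr)
      assume "\<not> g w > g p - \<eta>"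
      then have "w \<in> G i" using i gp by (intro net) (auto simp: p_def)
      with that show False ..
    qed
    have comb: "g (s *\<^sub>R p + t *\<^sub>R y) \<le> g p - a * s * t * (norm (p - y))\<^sup>2"
      if "s \<ge> 0" "t \<ge> 0" "s + t = 1" for s t
    proof -
      have "g (s *\<^sub>R p + t *\<^sub>R y) \<le> s * g p + t * g y - a * s * t * (norm (p - y))\<^sup>2"
        unfolding g_def using P a that by (intro energy_strongly_convex) auto
      also have "s * g p + t * g y \<le> s * g p + t * g p" using gy that by (simp add: mult_left_mono)
      also have "\<dots> = g p" using that by (simp flip: distrib_right)
      finally show ?thesis by simp
    qed
    have u: "u = 1 - v" using uv by simp
    define d where "d = norm (p - y)"
    have zp: "dist p z = v * d"
    proof -
      have "p - z = v *\<^sub>R (p - y)" unfolding zeq u by (simp add: algebra_simps)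
      then show ?thesis using uv by (simp add: dist_norm d_def)
    qed
    \<comment> \<open>If \<open>z\<close> is nearer to \<open>p\<close>, strong convexity is applied
      at \<open>z\<close> itself, which is outside \<open>G i\<close>. Otherwise the midpoint
      \<open>m\<close> is outside \<open>G i\<close> too, since \<open>z\<close> lies between
      \<open>m\<close> and \<open>y\<close>, and then the whole segment is short.\<close>
    have "v * d \<le> \<theta>"
    proof (cases "u \<ge> 1/2")
      case True
      have "g p - \<eta> < g z" using out z by blast
      also have "\<dots> \<le> g p - a * u * v * d\<^sup>2" unfolding zeq d_def using uv by (rule comb)
      finally have "a * u * v * d\<^sup>2 < a * \<theta>\<^sup>2 / 4" by (simp add: \<eta>_def)
      then have "a * (u * v * d\<^sup>2) < a * (\<theta>\<^sup>2 / 4)" by (simp add: mult.assoc)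
      then have "u * v * d\<^sup>2 < \<theta>\<^sup>2 / 4" using a by simp
      moreover have "v * v * d\<^sup>2 \<le> u * v * d\<^sup>2"
        using uv True by (intro mult_right_mono) auto
      ultimately have "v * v * d\<^sup>2 \<le> \<theta>\<^sup>2" using zero_le_power2[of \<theta>] by linarith
      then have "(v * d)\<^sup>2 \<le> \<theta>\<^sup>2" by (simp add: power2_eq_square mult.assoc mult.left_commute)
      then show ?thesis by (rule power2_le_imp_le) (use \<theta> in simp)
    next
      case False
      define m where "m = (1/2) *\<^sub>R p + (1/2) *\<^sub>R y"
      have "m \<notin> G i"
      proof
        assume "m \<in> G i"
        moreover have "z = (2 * u) *\<^sub>R m + (1 - 2 * u) *\<^sub>R y"
          unfolding zeq m_def u by (simp add: algebra_simps) (simp flip: scaleR_add_left)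
        moreover have "convex (G i)" by (simp add: G_def convex_convex_hull)
        ultimately have "z \<in> G i" using False uv y by (simp add: convexD)
        with z show False by blast
      qed
      from out[OF this] have "g p - \<eta> < g m" .
      also have "\<dots> \<le> g p - a * (1/2) * (1/2) * d\<^sup>2" unfolding m_def d_def by (rule comb) auto
      finally have "a * d\<^sup>2 < a * \<theta>\<^sup>2" by (simp add: \<eta>_def)
      then have "d\<^sup>2 \<le> \<theta>\<^sup>2" using a by simp
      then have "d \<le> \<theta>" by (rule power2_le_imp_le) (use \<theta> in simp)
      moreover have "v * d \<le> 1 * d" using uv by (intro mult_right_mono) (auto simp: d_def)
      ultimately show ?thesis by simp
    qed
    then show "z \<in> cball (xs ! i) \<theta>" using zp by (simp add: p_def)
  qed
  show thesis
  proof
    define Gs where "Gs = map G [1..<Suc (length xs)]"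
    have eq: "swell a \<rho> P # Gs = map G [0..<Suc (length xs)]"
      unfolding Gs_def using G0 by (simp add: U_def upt_conv_Cons del: upt_Suc)
    have "closed (G i)" for i
    proof -
      have "compact (U \<union> set (take i xs))"
        using compact_swell[OF a, of \<rho> P] by (simp add: U_def compact_Un finite_imp_compact)
      then show ?thesis unfolding G_def by (simp add: compact_convex_hull compact_imp_closed)
    qed
    then show "\<forall>G \<in> set Gs. closed G \<and> convex G" by (auto simp: Gs_def G_def convex_convex_hull)
    show "successively (\<lambda>G H. G \<subseteq> H \<and> (\<exists>c. H - G \<subseteq> cball c \<theta>)) (swell a \<rho> P # Gs)"
      unfolding eq successively_conv_nth using step by (auto simp del: upt_Suc)
    have "X \<subseteq> G (length xs)" using net[of "length xs"] XM by auto
    then show "X \<subseteq> last (swell a \<rho> P # Gs)" unfolding eq by simp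
  qed
qed

section \<open>Local growth\<close>

definition tiling :: "'a::real_normed_vector set \<Rightarrow> 'a set list \<Rightarrow> bool" where
  "tiling T xs \<longleftrightarrow> xs \<noteq> [] \<and> convex_blocks xs \<and> (\<forall>X \<in> set xs. closed X \<and> X \<noteq> {} \<and> X \<subseteq> T)"

text \<open>Covers both the norm and the extent in a coordinate direction.\<close>

definition subnorm :: "('a::real_normed_vector \<Rightarrow> real) \<Rightarrow> bool" where
  "subnorm f \<longleftrightarrow> (\<forall>x y. f (x + y) \<le> f x + f y) \<and> (\<forall>x. f x \<le> norm x)"

definition width_le :: "('a::real_normed_vector \<Rightarrow> real) \<Rightarrow> real \<Rightarrow> 'a set list \<Rightarrow> bool" where
  "width_le f w xs \<longleftrightarrow> (\<forall>X \<in> set xs. \<forall>x \<in> X. \<forall>y \<in> X. f (x - y) \<le> w)"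

text \<open>Intersecting such a chain with a tile gives the intermediate tiles to be inserted. Its
  members may stick out of \<open>T\<close>, so the steps are measured inside \<open>T\<close>
  only.\<close>

definition growable :: "real \<Rightarrow> 'a::real_normed_vector set \<Rightarrow> 'a set \<Rightarrow> bool" where
  "growable \<theta> T U \<longleftrightarrow> (\<exists>Gs. (\<forall>G \<in> set Gs. closed G \<and> convex G \<and> U \<subseteq> G) \<and>
     successively (\<lambda>G H. G \<subseteq> H \<and> (\<exists>c. T \<inter> (H - G) \<subseteq> cball c \<theta>)) (U # Gs) \<and> T \<subseteq> last (U # Gs))"

text \<open>Two radii are kept because one pass of insertions makes only the shrinking steps small,
  while the growing ones essentially keep their size.\<close>

definition small_step :: "real \<Rightarrow> real \<Rightarrow> 'a::metric_space set \<Rightarrow> 'a set \<Rightarrow> bool" where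
  "small_step \<theta> \<theta>' X Y \<longleftrightarrow>
     Y \<subseteq> X \<and> (\<exists>c. X - Y \<subseteq> cball c \<theta>) \<or> X \<subseteq> Y \<and> (\<exists>c. Y - X \<subseteq> cball c \<theta>')"

lemma map_eq_append3:
  assumes "map f xs = us @ vs @ ws"
  obtains us' vs' ws' where "xs = us' @ vs' @ ws'" "map f vs' = vs"
  using assms by (metis append_eq_map_conv)

lemma successively_subset_hd:
  assumes "successively (\<lambda>G H. G \<subseteq> H \<and> Q G H) (U # Gs)" "G \<in> set Gs"
  shows "U \<subseteq> G"
  using assms
proof (induction Gs arbitrary: U)
  case (Cons H Gs)
  then have "U \<subseteq> H" "G = H \<or> H \<subseteq> G" by auto
  then show ?case by blast
qed simp

section \<open>Swelling every tile of a list\<close>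

lemma growable_swell:
  fixes P T :: "'a::euclidean_space set"
  assumes P: "convex P" "closed P" "P \<noteq> {}" and a: "a > 0" and T: "bounded T"
    and ne: "swell a \<rho> P \<noteq> {}" and \<theta>: "\<theta> > 0"
  shows "growable \<theta> T (swell a \<rho> P \<inter> T)"
proof -
  obtain Gs where Gs: "\<forall>G \<in> set Gs. closed G \<and> convex G"
    "successively (\<lambda>G H. G \<subseteq> H \<and> (\<exists>c. H - G \<subseteq> cball c \<theta>)) (swell a \<rho> P # Gs)"
    "T \<subseteq> last (swell a \<rho> P # Gs)"
    by (rule swell_local_growth[OF P a T ne \<theta>])
  let ?S = "swell a \<rho> P"
  have "successively (\<lambda>G H. G \<subseteq> H \<and> (\<exists>c. T \<inter> (H - G) \<subseteq> cball c \<theta>)) (?S # Gs)"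
    using Gs(2) by (rule successively_mono) blast
  \<comment> \<open>Inside \<open>T\<close> the sets \<open>?S \<inter> T\<close> and
    \<open>?S\<close> agree, so this additional first step changes nothing there.\<close>
  moreover have "T \<inter> (?S - ?S \<inter> T) \<subseteq> cball 0 \<theta>" by blast
  ultimately have "successively (\<lambda>G H. G \<subseteq> H \<and> (\<exists>c. T \<inter> (H - G) \<subseteq> cball c \<theta>)) ((?S \<inter> T) # ?S # Gs)"
    by auto
  moreover have "\<forall>G \<in> set (?S # Gs). closed G \<and> convex G \<and> ?S \<inter> T \<subseteq> G"
    using Gs(1) successively_subset_hd[OF Gs(2)] closed_swell convex_swell P a by fastforce
  ultimately show ?thesis
    unfolding growable_def using Gs(3) by (intro exI[of _ "?S # Gs"]) auto
qed

lemma Union_map_swell: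
  assumes "ys \<noteq> []" "\<forall>Y \<in> set ys. Y \<noteq> {}"
  shows "\<Union> (set (map (\<lambda>X. swell a \<rho> X \<inter> T) ys)) = swell a \<rho> (\<Union> (set ys)) \<inter> T"
  using assms
proof (induction ys rule: list_nonempty_induct)
  case (cons x xs)
  then have "swell a \<rho> (x \<union> \<Union> (set xs)) = swell a \<rho> x \<union> swell a \<rho> (\<Union> (set xs))"
    by (intro swell_Un) (auto simp: neq_Nil_conv)
  with cons show ?case by auto
qed auto

lemma swell_list:
  fixes T :: "'a::euclidean_space set"
  assumes T: "convex T" "closed T" "bounded T" and xs: "tiling T xs" and \<mu>: "\<mu> > 0"
  obtains ys where "tiling T ys" "subdivides \<mu> xs ys"
    "\<And>f w. subnorm f \<Longrightarrow> width_le f w xs \<Longrightarrow> width_le f (w + 2 * \<mu>) ys"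
    "\<And>\<theta> us vs ws. \<theta> > 0 \<Longrightarrow> ys = us @ vs @ ws \<Longrightarrow> vs \<noteq> [] \<Longrightarrow> growable \<theta> T (\<Union> (set vs))"
    "\<And>\<theta>. successively (\<lambda>X Y. \<exists>c. Y - X \<subseteq> cball c \<theta>) xs \<Longrightarrow>
       successively (\<lambda>X Y. \<exists>c. Y - X \<subseteq> cball c (\<theta> + \<mu>)) ys"
    "\<And>Y. Y \<in> set ys \<Longrightarrow> \<exists>y \<in> Y. \<exists>r > 0. ball y r \<inter> T \<subseteq> Y"
proof -
  obtain R where R: "R > 0" "\<And>x. x \<in> T \<Longrightarrow> norm x \<le> R"
    using T(3) by (auto simp: bounded_pos)
  \<comment> \<open>With this factor the quadratic term is strictly below the square of
    \<open>\<mu>\<close> on \<open>T\<close>. Hence a tile lies in its swelling, and by strictness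
    the swelling contains a neighbourhood in \<open>T\<close> of each point of the tile.\<close>
  define a where "a = (\<mu> / (R + 1))\<^sup>2"
  have a: "a > 0" using R \<mu> by (simp add: a_def)
  have small: "a * (norm x)\<^sup>2 < \<mu>\<^sup>2" if "x \<in> T" for x
  proof -
    have "norm x < R + 1" using R(2)[OF that] by simp
    then have "\<mu> / (R + 1) * norm x < \<mu> / (R + 1) * (R + 1)"
      using R \<mu> by (intro mult_strict_left_mono) auto
    then have "\<mu> / (R + 1) * norm x < \<mu>" using R by simp
    then have "(\<mu> / (R + 1) * norm x)\<^sup>2 < \<mu>\<^sup>2" using R \<mu> by (intro power_strict_mono) auto
    then show ?thesis by (simp only: a_def power_mult_distrib)
  qed
  let ?f = "\<lambda>X. swell a \<mu> X \<inter> T"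
  have X: "closed X" "X \<noteq> {}" "X \<subseteq> T" "convex X" if "X \<in> set xs" for X
    using xs that by (auto simp: tiling_def convex_blocks_convex)
  have sub: "X \<subseteq> swell a \<mu> X" if "X \<subseteq> T" for X
    using small that by (auto simp: swell_def energy_def subset_iff intro: less_imp_le)
  have near: "\<exists>z \<in> X. dist z y \<le> \<mu>" if "closed X" "X \<noteq> {}" "y \<in> swell a \<mu> X" for X y
  proof -
    have "infdist y X \<le> \<mu>" using that a \<mu> by (intro infdist_swell) auto
    then show ?thesis using infdist_attains_inf[OF that(1,2), of y] by (metis dist_commute)
  qed
  have ref: "subdivides \<mu> xs (map ?f xs)"
  proof (rule subdivides_map, rule conjI)
    fix X assume XX: "X \<in> set xs"
    show "X \<subseteq> ?f X" using sub[of X] X(3)[OF XX] by simp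
    show "\<forall>y\<in>?f X. \<exists>z\<in>X. dist z y \<le> \<mu>" using near[OF X(1,2)[OF XX]] by simp
  qed
  have union: "\<Union> (set (map ?f vs)) = ?f (\<Union> (set vs))" "\<Union> (set vs) \<noteq> {}" "closed (\<Union> (set vs))"
    "\<Union> (set vs) \<subseteq> T" if "vs \<noteq> []" "set vs \<subseteq> set xs" for vs
  proof -
    show "\<Union> (set (map ?f vs)) = ?f (\<Union> (set vs))"
      using that X by (intro Union_map_swell) auto
    show "\<Union> (set vs) \<noteq> {}" using that X by (cases vs) auto
    show "closed (\<Union> (set vs))" using that X by (intro closed_Union) auto
    show "\<Union> (set vs) \<subseteq> T" using that X by blast
  qed
  show thesis
  proof
    have "convex_blocks (map ?f xs)"
    proof (rule convex_blocks_map)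
      show "convex_blocks xs" using xs by (simp add: tiling_def)
      fix vs assume "vs \<noteq> []" "set vs \<subseteq> set xs" "convex (\<Union> (set vs))"
      then show "convex (\<Union> (set (map ?f vs)))"
        using union[of vs] a T by (simp add: convex_Int convex_swell del: set_map)
    qed
    moreover have "closed (?f X)" "?f X \<noteq> {}" if "X \<in> set xs" for X
    proof -
      show "closed (?f X)" using T(2) closed_swell by (rule closed_Int[rotated])
      show "?f X \<noteq> {}" using X[OF that] sub[of X] by auto
    qed
    ultimately show "tiling T (map ?f xs)"
      using xs by (auto simp: tiling_def)
    show "subdivides \<mu> xs (map ?f xs)" by (rule ref)
    show "width_le f (w + 2 * \<mu>) (map ?f xs)" if f: "subnorm f" and w: "width_le f w xs" for f w
    proof -
      have "f (y - y') \<le> w + 2 * \<mu>" if h: "X0 \<in> set xs" "y \<in> ?f X0" "y' \<in> ?f X0" for X0 y y'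
      proof -
        obtain z where z: "z \<in> X0" "dist z y \<le> \<mu>" using near[OF X(1,2)[OF h(1)], of y] h(2) by blast
        obtain z' where z': "z' \<in> X0" "dist z' y' \<le> \<mu>" using near[OF X(1,2)[OF h(1)], of y'] h(3) by blast
        have "f (y - y') = f ((y - z) + ((z - z') + (z' - y')))" by simp
        also have "\<dots> \<le> f (y - z) + (f (z - z') + f (z' - y'))"
          using f unfolding subnorm_def by (meson add_left_mono order_trans)
        also have "\<dots> \<le> norm (y - z) + (w + norm (z' - y'))"
          using f w z(1) z'(1) h(1) unfolding subnorm_def width_le_def by (intro add_mono) auto
        finally show ?thesis using z z' by (simp add: dist_norm norm_minus_commute)
      qed
      then show ?thesis by (simp add: width_le_def)
    qed
    show "growable \<theta> T (\<Union> (set vs))" if h: "\<theta> > 0" "map ?f xs = us @ vs @ ws" "vs \<noteq> []" for \<theta> us vs ws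
    proof -
      obtain us' vs' ws' where *: "xs = us' @ vs' @ ws'" "map ?f vs' = vs"
        by (rule map_eq_append3[OF h(2)])
      then have vs': "vs' \<noteq> []" "set vs' \<subseteq> set xs" using h(3) by auto
      have "convex (\<Union> (set vs'))" using xs * unfolding tiling_def convex_blocks_def by blast
      moreover have "swell a \<mu> (\<Union> (set vs')) \<noteq> {}"
        using sub[OF union(4)[OF vs']] union(2)[OF vs'] by blast
      ultimately show ?thesis
        unfolding *(2)[symmetric] union(1)[OF vs'] using union(2,3)[OF vs'] a T(3) h(1)
        by (intro growable_swell)
    qed
    show "successively (\<lambda>X Y. \<exists>c. Y - X \<subseteq> cball c (\<theta> + \<mu>)) (map ?f xs)"
      if "successively (\<lambda>X Y. \<exists>c. Y - X \<subseteq> cball c \<theta>) xs" for \<theta>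
      unfolding successively_map
      using that
    proof (rule successively_mono)
      fix A B assume AB: "A \<in> set xs" "B \<in> set xs" "\<exists>c. B - A \<subseteq> cball c \<theta>"
      then obtain c where c: "B - A \<subseteq> cball c \<theta>" by blast
      show "\<exists>c. ?f B - ?f A \<subseteq> cball c (\<theta> + \<mu>)"
      proof (intro exI subsetI)
        fix y assume y: "y \<in> ?f B - ?f A"
        then obtain z where z: "z \<in> B" "infdist y B = dist y z"
          using infdist_attains_inf[OF X(1,2)[OF AB(2)], of y] by metis
        \<comment> \<open>If a point of \<open>B\<close> nearest to \<open>y\<close> were in
          \<open>A\<close>, the energy of \<open>y\<close> for \<open>A\<close> would not exceed
          that for \<open>B\<close>, and \<open>y\<close> would be in the swelling of
          \<open>A\<close>. So new points arise only within \<open>\<mu>\<close> of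
          \<open>B - A\<close>.\<close>
        have "z \<notin> A"
        proof
          assume "z \<in> A"
          then have "infdist y A \<le> infdist y B" using z by (simp add: infdist_le)
          then have "(infdist y A)\<^sup>2 \<le> (infdist y B)\<^sup>2" using infdist_nonneg by (rule power_mono)
          then show False using y by (auto simp: swell_def energy_def)
        qed
        then have "dist c z \<le> \<theta>" using c z(1) by auto
        moreover have "dist y z \<le> \<mu>" using infdist_swell[of y a \<mu> B] z(2) y a \<mu> by simp
        ultimately show "y \<in> cball c (\<theta> + \<mu>)"
          using dist_triangle2[of c y z] by (simp add: dist_commute)
      qed
    qed
    show "\<exists>y \<in> Y. \<exists>r > 0. ball y r \<inter> T \<subseteq> Y" if "Y \<in> set (map ?f xs)" for Y
    proof -
      from that obtain X0 where X0: "X0 \<in> set xs" "Y = ?f X0" by auto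
      with X obtain x where x: "x \<in> X0" "x \<in> T" by blast
      have "open {y. energy a X0 y < \<mu>\<^sup>2}"
        using continuous_on_energy by (intro open_Collect_less continuous_on_const) auto
      moreover have "x \<in> {y. energy a X0 y < \<mu>\<^sup>2}" using x small by (simp add: energy_def)
      ultimately obtain r where "r > 0" "ball x r \<subseteq> {y. energy a X0 y < \<mu>\<^sup>2}"
        by (meson open_contains_ball)
      then have "ball x r \<inter> T \<subseteq> Y" unfolding X0(2) swell_def by force
      moreover have "x \<in> Y" unfolding X0(2) using sub X X0(1) x by blast
      ultimately show ?thesis using \<open>r > 0\<close> by blast
    qed
  qed
qed

text \<open>
  Read \<open>U \<union> p\<close> as a prefix union of the list behind the current tile.  All of them have to stay
  convex while \<open>X\<close> is approached from \<open>X \<inter> U\<close>, so \<open>X\<close> is filled up inside one prefix union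
  \<open>V\<close> after another, with \<open>X \<inter> V \<inter> G\<close> for \<open>G\<close> growing from the previous prefix union.
\<close>

lemma chain_extension:
  fixes T :: "'a::euclidean_space set"
  assumes "X \<subseteq> T" "closed X"
    and "\<And>p. p \<in> prefix_unions zs \<Longrightarrow> closed (U \<union> p) \<and> convex (U \<union> p) \<and> convex (U \<union> p \<union> X) \<and> growable \<theta> T (U \<union> p)"
  shows "\<exists>Es. (\<forall>E \<in> set Es. closed E \<and> E \<subseteq> X \<and> (\<forall>p \<in> prefix_unions zs. convex (U \<union> p \<union> E)) \<and>
        (\<forall>B. B \<subseteq> U \<and> convex (B \<union> X) \<longrightarrow> convex (B \<union> E))) \<and>
      successively (\<lambda>E F. E \<subseteq> F \<and> (\<exists>c. F - E \<subseteq> cball c \<theta>)) ((X \<inter> U) # Es) \<and>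
      X \<subseteq> last ((X \<inter> U) # Es)"
  using assms
proof (induction zs arbitrary: U)
  case Nil
  then obtain Gs where Gs: "\<forall>G \<in> set Gs. closed G \<and> convex G \<and> U \<subseteq> G"
    "successively (\<lambda>G H. G \<subseteq> H \<and> (\<exists>c. T \<inter> (H - G) \<subseteq> cball c \<theta>)) (U # Gs)" "T \<subseteq> last (U # Gs)"
    unfolding growable_def by auto
  \<comment> \<open>Since \<open>B \<subseteq> U \<subseteq> G\<close>, cutting only
    \<open>X\<close> by \<open>G\<close> amounts to cutting the whole union by the convex set
    \<open>G\<close>.\<close>
  have cut: "convex (B \<union> X \<inter> G)" if "G \<in> set Gs" "B \<subseteq> U" "convex (B \<union> X)" for B G
  proof -
    have "B \<union> X \<inter> G = (B \<union> X) \<inter> G" using that Gs(1) by blast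
    then show ?thesis using that Gs(1) by (simp add: convex_Int)
  qed
  have "successively (\<lambda>E F. E \<subseteq> F \<and> (\<exists>c. F - E \<subseteq> cball c \<theta>)) (map ((\<inter>) X) (U # Gs))"
    unfolding successively_map using Gs(2)
  proof (rule successively_mono)
    fix G H assume "G \<subseteq> H \<and> (\<exists>c. T \<inter> (H - G) \<subseteq> cball c \<theta>)"
    then show "X \<inter> G \<subseteq> X \<inter> H \<and> (\<exists>c. X \<inter> H - X \<inter> G \<subseteq> cball c \<theta>)"
      using Nil.prems(1) by blast
  qed
  moreover have "X \<subseteq> last (map ((\<inter>) X) (U # Gs))"
  proof -
    have "last (map ((\<inter>) X) (U # Gs)) = X \<inter> last (U # Gs)" by (rule last_map) simp
    then show ?thesis using Gs(3) Nil.prems(1) by blast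
  qed
  ultimately show ?case
    using cut Gs(1) Nil.prems by (intro exI[of _ "map ((\<inter>) X) Gs"]) (auto simp: closed_Int)
next
  case (Cons z zs)
  define V where "V = U \<union> z"
  have sub: "z \<union> p \<in> prefix_unions (z # zs)" if "p \<in> prefix_unions zs" for p
    using that by (auto simp: prefix_unions_Cons)
  have "closed (V \<union> p) \<and> convex (V \<union> p) \<and> convex (V \<union> p \<union> X) \<and> growable \<theta> T (V \<union> p)"
    if "p \<in> prefix_unions zs" for p
    using Cons.prems(3)[OF sub[OF that]] by (simp add: V_def Un_assoc)
  from Cons.IH[OF Cons.prems(1,2) this] obtain Es where
    Es: "\<forall>E \<in> set Es. closed E \<and> E \<subseteq> X \<and> (\<forall>p \<in> prefix_unions zs. convex (V \<union> p \<union> E)) \<and>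
        (\<forall>B. B \<subseteq> V \<and> convex (B \<union> X) \<longrightarrow> convex (B \<union> E))"
      "successively (\<lambda>E F. E \<subseteq> F \<and> (\<exists>c. F - E \<subseteq> cball c \<theta>)) ((X \<inter> V) # Es)"
      "X \<subseteq> last ((X \<inter> V) # Es)"
    by blast
  have U: "closed U" "convex (U \<union> X)" "growable \<theta> T U"
    using Cons.prems(3)[of "{}"] by auto
  have V: "closed V" "convex V"
    using Cons.prems(3)[OF sub[of "{}"]] by (auto simp: V_def)
  from U(3) obtain Gs where Gs: "\<forall>G \<in> set Gs. closed G \<and> convex G \<and> U \<subseteq> G"
    "successively (\<lambda>G H. G \<subseteq> H \<and> (\<exists>c. T \<inter> (H - G) \<subseteq> cball c \<theta>)) (U # Gs)" "T \<subseteq> last (U # Gs)"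
    unfolding growable_def by auto
  \<comment> \<open>These sets fill up \<open>X \<inter> V\<close> and stay inside \<open>V\<close>.
    A union \<open>U \<union> p\<close> with non-empty \<open>p\<close> contains \<open>V\<close>
    and is not changed by them; the chain of the induction hypothesis then continues from
    \<open>X \<inter> V\<close>.\<close>
  let ?E1 = "map (\<lambda>G. X \<inter> V \<inter> G) Gs"
  have hdU: "(X \<inter> U) # ?E1 = map (\<lambda>G. X \<inter> V \<inter> G) (U # Gs)" by (auto simp: V_def)
  have lastE1: "last ((X \<inter> U) # ?E1) = X \<inter> V"
  proof -
    have "last ((X \<inter> U) # ?E1) = X \<inter> V \<inter> last (U # Gs)"
      unfolding hdU by (rule last_map) simp
    then show ?thesis using Gs(3) Cons.prems(1) by blast
  qed
  have cut: "convex (B \<union> X \<inter> V \<inter> G)" if "G \<in> set Gs" "B \<subseteq> U" "convex (B \<union> X)" for B G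
  proof -
    have "B \<union> X \<inter> V \<inter> G = (B \<union> X) \<inter> V \<inter> G" using that Gs(1) by (auto simp: V_def)
    then show ?thesis using that Gs(1) V by (simp add: convex_Int)
  qed
  have "successively (\<lambda>E F. E \<subseteq> F \<and> (\<exists>c. F - E \<subseteq> cball c \<theta>)) ((X \<inter> U) # ?E1)"
    unfolding hdU successively_map using Gs(2)
  proof (rule successively_mono)
    fix G H assume "G \<subseteq> H \<and> (\<exists>c. T \<inter> (H - G) \<subseteq> cball c \<theta>)"
    then show "X \<inter> V \<inter> G \<subseteq> X \<inter> V \<inter> H \<and> (\<exists>c. X \<inter> V \<inter> H - X \<inter> V \<inter> G \<subseteq> cball c \<theta>)"
      using Cons.prems(1) by blast
  qed
  then have "successively (\<lambda>E F. E \<subseteq> F \<and> (\<exists>c. F - E \<subseteq> cball c \<theta>)) (((X \<inter> U) # ?E1) @ Es)"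
    unfolding successively_append_iff lastE1 using Es(2) by (auto simp: successively_Cons)
  moreover have "X \<subseteq> last (((X \<inter> U) # ?E1) @ Es)"
  proof (cases "Es = []")
    case True
    then have "X \<subseteq> X \<inter> V" using Es(3) by simp
    then show ?thesis unfolding True append_Nil2 lastE1 .
  next
    case False
    then show ?thesis using Es(3) by (simp only: last_append last.simps if_False)
  qed
  moreover have "closed E \<and> E \<subseteq> X \<and> (\<forall>p \<in> prefix_unions (z # zs). convex (U \<union> p \<union> E)) \<and>
        (\<forall>B. B \<subseteq> U \<and> convex (B \<union> X) \<longrightarrow> convex (B \<union> E))" if "E \<in> set (?E1 @ Es)" for E
  proof -
    \<comment> \<open>The clause on subsets passes from \<open>V\<close> down to the smaller set
      \<open>U\<close>. Its instance \<open>B = U\<close> is what settles the empty prefix: the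
      other clause of the induction hypothesis speaks only of sets containing
      \<open>V\<close>.\<close>
    have B: "convex (B \<union> E)" if "B \<subseteq> U" "convex (B \<union> X)" for B
    proof (cases "E \<in> set Es")
      case True
      moreover have "B \<subseteq> V" using that(1) by (auto simp: V_def)
      ultimately show ?thesis using Es(1) that(2) by blast
    next
      case False
      then obtain G where "G \<in> set Gs" "E = X \<inter> V \<inter> G" using \<open>E \<in> set (?E1 @ Es)\<close> by auto
      then show ?thesis using cut[of G B] that by simp
    qed
    have "closed E \<and> E \<subseteq> X"
      using that Es(1) Gs(1) V(1) Cons.prems(2) by (auto intro!: closed_Int)
    moreover have "convex (U \<union> p \<union> E)" if p: "p \<in> prefix_unions (z # zs)" for p
    proof (cases "p = {}")
      case True
      then show ?thesis using B[of U] U by simp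
    next
      case False
      then obtain q where q: "q \<in> prefix_unions zs" "p = z \<union> q" using p by (auto simp: prefix_unions_Cons)
      show ?thesis
      proof (cases "E \<in> set Es")
        case True
        then have "convex (V \<union> q \<union> E)" using Es(1) q(1) by blast
        then show ?thesis using q(2) by (simp add: V_def Un_assoc)
      next
        case False
        then have "E \<subseteq> V" using \<open>E \<in> set (?E1 @ Es)\<close> by auto
        then have "U \<union> p \<union> E = U \<union> p" using q by (auto simp: V_def)
        then show ?thesis using Cons.prems(3)[OF p] by simp
      qed
    qed
    ultimately show ?thesis using B by blast
  qed
  ultimately show ?case by (intro exI[of _ "?E1 @ Es"]) auto
qed


text \<open>As the sets in \<open>Fs\<close> decrease, a block starting in \<open>Fs\<close> has the
  union \<open>F \<union> s\<close>, where \<open>F\<close> is its first member and \<open>s\<close>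
  a prefix union of \<open>ys\<close>. Only these unions have to be convex.\<close>

lemma convex_blocks_descending:
  assumes "convex_blocks ys" "\<forall>F \<in> set Fs. \<forall>s \<in> prefix_unions ys. convex (F \<union> s)"
    and "successively (\<lambda>F H. H \<subseteq> F) Fs"
  shows "convex_blocks (Fs @ ys) \<and>
    (Fs \<noteq> [] \<longrightarrow> prefix_unions (Fs @ ys) \<subseteq> insert {} ((\<union>) (hd Fs) ` prefix_unions ys))"
  using assms
proof (induction Fs)
  case (Cons F Fs)
  then have IH: "convex_blocks (Fs @ ys)"
    "Fs \<noteq> [] \<Longrightarrow> prefix_unions (Fs @ ys) \<subseteq> insert {} ((\<union>) (hd Fs) ` prefix_unions ys)"
    by (auto simp: successively_Cons)
  have sub: "prefix_unions (F # Fs @ ys) \<subseteq> insert {} ((\<union>) F ` prefix_unions ys)"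
  proof (cases "Fs = []")
    case False
    then have "hd Fs \<subseteq> F" using Cons.prems(3) by (simp add: successively_Cons)
    have "F \<union> s \<in> (\<union>) F ` prefix_unions ys" if "s \<in> prefix_unions (Fs @ ys)" for s
    proof -
      from that IH(2)[OF False] have "s = {} \<or> (\<exists>t \<in> prefix_unions ys. s = hd Fs \<union> t)" by blast
      then have "\<exists>t \<in> prefix_unions ys. F \<union> s = F \<union> t"
      proof
        assume "s = {}"
        then show ?thesis using empty_in_prefix_unions[of ys] by blast
      next
        assume "\<exists>t \<in> prefix_unions ys. s = hd Fs \<union> t"
        then obtain t where "t \<in> prefix_unions ys" "s = hd Fs \<union> t" by blast
        moreover have "F \<union> (hd Fs \<union> t) = F \<union> t" using \<open>hd Fs \<subseteq> F\<close> by blast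
        ultimately show ?thesis by blast
      qed
      then show ?thesis by blast
    qed
    then show ?thesis by (auto simp: prefix_unions_Cons)
  qed (simp add: prefix_unions_Cons)
  moreover have "convex s" if "s \<in> prefix_unions (F # Fs @ ys)" for s
  proof -
    from that sub have "s = {} \<or> (\<exists>p \<in> prefix_unions ys. s = F \<union> p)" by blast
    then show ?thesis using Cons.prems(2) by auto
  qed
  ultimately show ?case using IH(1) by (simp add: convex_blocks_Cons)
qed auto

text \<open>From \<open>X\<close> to the next tile \<open>A\<close> the new list jumps up to
  \<open>A \<union> X\<close> and descends to \<open>A\<close> through sets
  \<open>A \<union> E\<close> with \<open>E\<close> from \<open>chain_extension\<close>. The
  conclusions on \<open>hd\<close> and \<open>prefix_unions\<close> carry the induction: the rest
  starts with \<open>A\<close>, and every prefix union of the new list is one of the old list, hence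
  convex.\<close>

lemma growable_insertion:
  fixes T :: "'a::euclidean_space set"
  assumes "tiling T zs" "0 \<le> \<theta>" "0 \<le> \<theta>'"
    and "\<And>us vs ws. zs = us @ vs @ ws \<Longrightarrow> vs \<noteq> [] \<Longrightarrow> growable \<theta> T (\<Union> (set vs))"
    and "successively (\<lambda>X Y. \<exists>c. Y - X \<subseteq> cball c \<theta>') zs"
  shows "\<exists>yss. list_all2 (\<lambda>Z ys. Z \<in> set ys \<and>
             (\<forall>Y \<in> set ys. \<exists>Z' \<in> set zs. Z \<inter> Z' \<noteq> {} \<and> Y \<subseteq> Z \<union> Z')) zs yss \<and>
      tiling T (concat yss) \<and> hd (concat yss) = hd zs \<and>
      prefix_unions (concat yss) \<subseteq> prefix_unions zs \<and>
      successively (small_step \<theta> \<theta>') (concat yss)"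
  using assms
proof (induction zs)
  case Nil
  then show ?case by (simp add: tiling_def)
next
  case (Cons X zs)
  have X: "closed X" "X \<noteq> {}" "X \<subseteq> T" and cX: "convex_blocks (X # zs)"
    using Cons.prems(1) by (auto simp: tiling_def)
  show ?case
  proof (cases zs)
    case Nil
    then show ?thesis
      using Cons.prems(1) X by (intro exI[of _ "[[X]]"]) auto
  next
    case (Cons A zs')
    have A: "closed A" "A \<noteq> {}" "A \<subseteq> T" and Z: "\<And>Z. Z \<in> set zs' \<Longrightarrow> closed Z \<and> Z \<subseteq> T"
      using Cons.prems(1) Cons by (auto simp: tiling_def)
    have t: "tiling T zs"
      using Cons.prems(1) Cons by (auto simp: tiling_def convex_blocks_Cons)
    obtain yss where yss: "list_all2 (\<lambda>Z ys. Z \<in> set ys \<and>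
             (\<forall>Y \<in> set ys. \<exists>Z' \<in> set zs. Z \<inter> Z' \<noteq> {} \<and> Y \<subseteq> Z \<union> Z')) zs yss"
      "tiling T (concat yss)" "hd (concat yss) = A" "prefix_unions (concat yss) \<subseteq> prefix_unions zs"
      "successively (small_step \<theta> \<theta>') (concat yss)"
    proof -
      have "growable \<theta> T (\<Union> (set vs))" if "zs = us @ vs @ ws" "vs \<noteq> []" for us vs ws
        using Cons.prems(4)[of "X # us" vs ws] that by simp
      moreover have "successively (\<lambda>X Y. \<exists>c. Y - X \<subseteq> cball c \<theta>') zs"
        using Cons.prems(5) Cons by simp
      ultimately show thesis using Cons.IH[OF t Cons.prems(2,3)] that Cons by auto
    qed
    define ys where "ys = concat yss"
    have up: "\<exists>c. A - X \<subseteq> cball c \<theta>'" using Cons.prems(5) Cons by simp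
    have XA: "convex (X \<union> (A \<union> p))" if "p \<in> prefix_unions zs'" for p
    proof -
      have "X \<union> (A \<union> p) \<in> prefix_unions (X # zs)"
        using that unfolding Cons prefix_unions_Cons by blast
      then show ?thesis using cX by (rule convex_prefix_unions[rotated])
    qed
    have Ap: "closed (A \<union> p) \<and> convex (A \<union> p) \<and> convex (A \<union> p \<union> X) \<and> growable \<theta> T (A \<union> p)"
      if p: "p \<in> prefix_unions zs'" for p
    proof -
      from p obtain us ws where us: "p = \<Union> (set us)" "zs' = us @ ws"
        unfolding prefix_unions_def by blast
      have "closed p" unfolding us(1) using Z us(2) by (intro closed_Union) auto
      then have "closed (A \<union> p)" using A by (simp add: closed_Un)
      moreover have "convex (A \<union> p)"
      proof (rule convex_prefix_unions)
        show "convex_blocks zs" using t by (simp add: tiling_def)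
        show "A \<union> p \<in> prefix_unions zs" unfolding Cons prefix_unions_Cons using p by blast
      qed
      moreover have "convex (A \<union> p \<union> X)" using XA[OF p] by (simp add: Un_commute)
      moreover have "growable \<theta> T (\<Union> (set (A # us)))"
        using Cons us by (intro Cons.prems(4)[of "[X]" _ ws]) auto
      ultimately show ?thesis using us(1) by simp
    qed
    have "\<exists>Es. (\<forall>E \<in> set Es. closed E \<and> E \<subseteq> X \<and> (\<forall>p \<in> prefix_unions zs'. convex (A \<union> p \<union> E)) \<and>
        (\<forall>B. B \<subseteq> A \<and> convex (B \<union> X) \<longrightarrow> convex (B \<union> E))) \<and>
      successively (\<lambda>E F. E \<subseteq> F \<and> (\<exists>c. F - E \<subseteq> cball c \<theta>)) ((X \<inter> A) # Es) \<and>
      X \<subseteq> last ((X \<inter> A) # Es)" (is "\<exists>Es. ?chain Es")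
      by (rule chain_extension[OF X(3,1)]) (rule Ap)
    then obtain Es where "?chain Es" by (elim exE) (rule that)
    then have Es: "\<forall>E \<in> set Es. closed E \<and> E \<subseteq> X \<and> (\<forall>p \<in> prefix_unions zs'. convex (A \<union> p \<union> E))"
      "successively (\<lambda>E F. E \<subseteq> F \<and> (\<exists>c. F - E \<subseteq> cball c \<theta>)) ((X \<inter> A) # Es)"
      "X \<subseteq> last ((X \<inter> A) # Es)"
    proof -
      assume chain: "?chain Es"
      show "\<forall>E \<in> set Es. closed E \<and> E \<subseteq> X \<and> (\<forall>p \<in> prefix_unions zs'. convex (A \<union> p \<union> E))"
        using chain[THEN conjunct1] by simp
      show "successively (\<lambda>E F. E \<subseteq> F \<and> (\<exists>c. F - E \<subseteq> cball c \<theta>)) ((X \<inter> A) # Es)"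
        by (rule chain[THEN conjunct2, THEN conjunct1])
      show "X \<subseteq> last ((X \<inter> A) # Es)"
        by (rule chain[THEN conjunct2, THEN conjunct2])
    qed
    \<comment> \<open>The chain grows from \<open>X \<inter> A\<close> to \<open>X\<close>, so it is
      reversed here; keeping \<open>X \<inter> A\<close> makes the last set exactly
      \<open>A\<close>.\<close>
    define Fs where "Fs = rev (map ((\<union>) A) ((X \<inter> A) # Es))"
    have F: "\<exists>E. F = A \<union> E \<and> E \<subseteq> X \<and> closed E \<and> (\<forall>p \<in> prefix_unions zs'. convex (A \<union> p \<union> E))"
      if "F \<in> set Fs" for F
    proof -
      have "F \<in> (\<union>) A ` set ((X \<inter> A) # Es)" using that by (simp only: Fs_def set_rev set_map)
      then obtain E where E: "F = A \<union> E" "E \<in> set ((X \<inter> A) # Es)" by (rule imageE)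
      then have "E = X \<inter> A \<or> E \<in> set Es" by simp
      then have "E \<subseteq> X \<and> closed E \<and> (\<forall>p \<in> prefix_unions zs'. convex (A \<union> p \<union> E))"
      proof
        assume E': "E = X \<inter> A"
        have "convex (A \<union> p \<union> E)" if "p \<in> prefix_unions zs'" for p
        proof -
          have "A \<union> p \<union> E = A \<union> p" using E' by blast
          then show ?thesis using Ap[OF that] by simp
        qed
        then show ?thesis using E' closed_Int[OF X(1) A(1)] by blast
      next
        assume "E \<in> set Es"
        with Es(1) show ?thesis by blast
      qed
      then show ?thesis using E(1) by blast
    qed
    have Fs0: "Fs \<noteq> []" by (simp add: Fs_def)
    have lastF: "last Fs = A" by (auto simp: Fs_def last_rev)
    have hdF: "hd Fs = A \<union> X"
    proof -
      have "hd Fs = last (map ((\<union>) A) ((X \<inter> A) # Es))" unfolding Fs_def by (rule hd_rev)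
      also have "\<dots> = A \<union> last ((X \<inter> A) # Es)" by (rule last_map) simp
      also have "last ((X \<inter> A) # Es) \<subseteq> X" using Es(1) by (cases "Es = []") auto
      then have "A \<union> last ((X \<inter> A) # Es) = A \<union> X" using Es(3) by blast
      finally show ?thesis .
    qed
    have stepF: "successively (\<lambda>F H. H \<subseteq> F \<and> (\<exists>c. F - H \<subseteq> cball c \<theta>)) Fs"
      unfolding Fs_def successively_rev successively_map using Es(2)
    proof (rule successively_mono)
      fix E F :: "'a set" assume "E \<subseteq> F \<and> (\<exists>c. F - E \<subseteq> cball c \<theta>)"
      then show "A \<union> E \<subseteq> A \<union> F \<and> (\<exists>c. A \<union> F - (A \<union> E) \<subseteq> cball c \<theta>)" by blast
    qed
    have pys: "s = {} \<or> (\<exists>p \<in> prefix_unions zs'. s = A \<union> p)" if "s \<in> prefix_unions ys" for s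
      using that yss(4) unfolding ys_def Cons prefix_unions_Cons by blast
    have desc: "convex_blocks (Fs @ ys)" "prefix_unions (Fs @ ys) \<subseteq> insert {} ((\<union>) (A \<union> X) ` prefix_unions ys)"
    proof -
      have "convex (F \<union> s)" if h: "F \<in> set Fs" "s \<in> prefix_unions ys" for F s
      proof -
        obtain E where E: "F = A \<union> E" "\<forall>p \<in> prefix_unions zs'. convex (A \<union> p \<union> E)"
          using F[OF h(1)] by blast
        from pys[OF h(2)] show ?thesis
        proof
          assume "s = {}"
          then show ?thesis using E(2)[rule_format, of "{}"] E(1) by simp
        next
          assume "\<exists>p \<in> prefix_unions zs'. s = A \<union> p"
          then obtain p where "p \<in> prefix_unions zs'" "s = A \<union> p" by blast
          moreover have "A \<union> E \<union> (A \<union> p) = A \<union> p \<union> E" by blast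
          ultimately show ?thesis using E by simp
        qed
      qed
      moreover have "successively (\<lambda>F H. H \<subseteq> F) Fs" using stepF by (rule successively_mono) blast
      moreover have "convex_blocks ys" using yss(2) by (simp add: ys_def tiling_def)
      ultimately show "convex_blocks (Fs @ ys)"
        "prefix_unions (Fs @ ys) \<subseteq> insert {} ((\<union>) (A \<union> X) ` prefix_unions ys)"
        using convex_blocks_descending[of ys Fs] Fs0 hdF by auto
    qed
    have pre: "prefix_unions (X # Fs @ ys) \<subseteq> prefix_unions (X # zs)"
    proof
      fix s assume "s \<in> prefix_unions (X # Fs @ ys)"
      then consider "s = {}" | "s = X \<union> {}" | q where "q \<in> prefix_unions ys" "s = X \<union> (A \<union> X \<union> q)"
        using desc(2) unfolding prefix_unions_Cons by blast
      then show "s \<in> prefix_unions (X # zs)"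
      proof cases
        case 2
        then show ?thesis unfolding prefix_unions_Cons by (meson empty_in_prefix_unions imageI insertI2)
      next
        case 3
        then have "s = X \<union> A \<or> (\<exists>p \<in> prefix_unions zs'. s = X \<union> (A \<union> p))"
          using pys[OF 3(1)] by blast
        then have "\<exists>p \<in> prefix_unions zs'. s = X \<union> (A \<union> p)"
          using empty_in_prefix_unions[of zs'] by (metis Un_empty_right)
        then show ?thesis unfolding Cons prefix_unions_Cons by blast
      qed simp
    qed
    \<comment> \<open>Two disjoint non-empty closed sets have a disconnected union. The common point
      later bounds the width of the sets inside \<open>X \<union> A\<close>.\<close>
    have "X \<inter> A \<noteq> {}"
    proof -
      have "convex (X \<union> A)" using XA[of "{}"] by simp
      then have "connected (X \<union> A)" by (rule convex_connected)
      then show ?thesis using X A unfolding connected_closed by blast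
    qed
    have pieces: "\<exists>Z' \<in> set (X # zs). X \<inter> Z' \<noteq> {} \<and> Y \<subseteq> X \<union> Z'" if "Y \<in> set (X # Fs)" for Y
    proof -
      have "Y \<subseteq> X \<union> A" using F that by auto
      then show ?thesis using \<open>X \<inter> A \<noteq> {}\<close> Cons by auto
    qed
    have tl: "tiling T (X # Fs @ ys)"
    proof -
      have "convex_blocks (X # Fs @ ys)"
        unfolding convex_blocks_Cons using desc(1) pre cX convex_prefix_unions by blast
      moreover have "closed Y \<and> Y \<noteq> {} \<and> Y \<subseteq> T" if "Y \<in> set Fs" for Y
        using F[OF that] A X by auto
      moreover have "closed Y \<and> Y \<noteq> {} \<and> Y \<subseteq> T" if "Y \<in> set ys" for Y
        using yss(2) that unfolding tiling_def ys_def by blast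
      ultimately show ?thesis using X unfolding tiling_def by (simp, blast)
    qed
    have st: "successively (small_step \<theta> \<theta>') (X # Fs @ ys)"
    proof -
      have "small_step \<theta> \<theta>' X (hd Fs)"
        using up unfolding hdF small_step_def by (intro disjI2) (simp add: Un_Diff)
      moreover have "small_step \<theta> \<theta>' (last Fs) (hd ys)"
        unfolding lastF small_step_def using yss(3) by (simp add: ys_def)
      moreover have "successively (small_step \<theta> \<theta>') Fs"
        using stepF by (rule successively_mono) (simp add: small_step_def)
      ultimately show ?thesis
        using yss(5) Fs0 by (simp add: successively_Cons successively_append_iff ys_def)
    qed
    have la: "list_all2 (\<lambda>Z ys. Z \<in> set ys \<and>
       (\<forall>Y \<in> set ys. \<exists>Z' \<in> set (X # zs). Z \<inter> Z' \<noteq> {} \<and> Y \<subseteq> Z \<union> Z')) (X # zs) ((X # Fs) # yss)"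
    proof -
      have "list_all2 (\<lambda>Z ys. Z \<in> set ys \<and>
         (\<forall>Y \<in> set ys. \<exists>Z' \<in> set (X # zs). Z \<inter> Z' \<noteq> {} \<and> Y \<subseteq> Z \<union> Z')) zs yss"
        using yss(1) by (rule list_all2_mono) auto
      then show ?thesis using pieces by auto
    qed
    have eq: "concat ((X # Fs) # yss) = X # Fs @ ys" by (simp add: ys_def)
    show ?thesis
      by (rule exI[of _ "(X # Fs) # yss"], unfold eq, intro conjI la tl st pre, simp)
  qed
qed

section \<open>Localising the difference of consecutive tiles\<close>

lemma list_all2_set2: "list_all2 P xs ys \<Longrightarrow> y \<in> set ys \<Longrightarrow> \<exists>x \<in> set xs. P x y"
  by (induction rule: list_all2_induct) auto

lemma subnorm_norm: "subnorm norm"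
  by (simp add: subnorm_def norm_triangle_ineq)

text \<open>Swelling by \<open>\<mu>\<close> adds \<open>\<mu>\<close> to the growth radius and
  \<open>2 * \<mu>\<close> to the widths. The inserted tiles then lie in unions
  \<open>Z \<union> Z'\<close> of two tiles with a common point, which doubles the widths and
  displaces points by at most the diameter of \<open>Z'\<close>.\<close>

lemma localise_growth:
  fixes T :: "'a::euclidean_space set"
  assumes T: "convex T" "closed T" "bounded T" and xs: "tiling T xs"
    and pos: "\<theta> > 0" "\<theta>' \<ge> 0" "\<mu> > 0"
    and up: "successively (\<lambda>X Y. \<exists>c. Y - X \<subseteq> cball c \<theta>') xs"
  obtains ys where "tiling T ys" "successively (small_step \<theta> (\<theta>' + \<mu>)) ys"
    "\<And>D. width_le norm D xs \<Longrightarrow> subdivides (D + 3 * \<mu>) xs ys"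
    "\<And>f w. subnorm f \<Longrightarrow> width_le f w xs \<Longrightarrow> width_le f (2 * w + 4 * \<mu>) ys"
proof -
  obtain zs where zs: "tiling T zs" "subdivides \<mu> xs zs"
    "\<And>f w. subnorm f \<Longrightarrow> width_le f w xs \<Longrightarrow> width_le f (w + 2 * \<mu>) zs"
    "\<And>\<theta> us vs ws. \<theta> > 0 \<Longrightarrow> zs = us @ vs @ ws \<Longrightarrow> vs \<noteq> [] \<Longrightarrow> growable \<theta> T (\<Union> (set vs))"
    "\<And>\<theta>. successively (\<lambda>X Y. \<exists>c. Y - X \<subseteq> cball c \<theta>) xs \<Longrightarrow>
       successively (\<lambda>X Y. \<exists>c. Y - X \<subseteq> cball c (\<theta> + \<mu>)) zs"
    by (rule swell_list[OF T xs pos(3)]) (rule that)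
  have grow: "growable \<theta> T (\<Union> (set vs))" if "zs = us @ vs @ ws" "vs \<noteq> []" for us vs ws
    using pos(1) that by (rule zs(4))
  have "\<exists>yss. list_all2 (\<lambda>Z ys. Z \<in> set ys \<and>
             (\<forall>Y \<in> set ys. \<exists>Z' \<in> set zs. Z \<inter> Z' \<noteq> {} \<and> Y \<subseteq> Z \<union> Z')) zs yss \<and>
      tiling T (concat yss) \<and> hd (concat yss) = hd zs \<and>
      prefix_unions (concat yss) \<subseteq> prefix_unions zs \<and>
      successively (small_step \<theta> (\<theta>' + \<mu>)) (concat yss)"
    using zs(1) _ _ grow zs(5)[OF up] by (rule growable_insertion) (use pos in simp_all)
  then obtain yss where yss: "list_all2 (\<lambda>Z ys. Z \<in> set ys \<and>
             (\<forall>Y \<in> set ys. \<exists>Z' \<in> set zs. Z \<inter> Z' \<noteq> {} \<and> Y \<subseteq> Z \<union> Z')) zs yss"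
      "tiling T (concat yss)" "successively (small_step \<theta> (\<theta>' + \<mu>)) (concat yss)"
    by blast
  show thesis
  proof
    show "tiling T (concat yss)" "successively (small_step \<theta> (\<theta>' + \<mu>)) (concat yss)"
      by (rule yss(2,3))+
    show "subdivides (D + 3 * \<mu>) xs (concat yss)" if D: "width_le norm D xs" for D
    proof -
      have w: "width_le norm (D + 2 * \<mu>) zs" using zs(3)[OF subnorm_norm D] .
      have "list_all2 (near_cover (D + 2 * \<mu>)) zs yss"
      proof (rule list.rel_mono_strong[OF yss(1)])
        fix Z ys assume Z: "Z \<in> set zs" and
          ys: "Z \<in> set ys \<and> (\<forall>Y \<in> set ys. \<exists>Z' \<in> set zs. Z \<inter> Z' \<noteq> {} \<and> Y \<subseteq> Z \<union> Z')"
        have "\<exists>x \<in> Z. dist x y \<le> D + 2 * \<mu>" if Y: "Y \<in> set ys" "y \<in> Y" for Y y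
        proof -
          obtain Z' q where Z': "Z' \<in> set zs" "q \<in> Z" "q \<in> Z'" "Y \<subseteq> Z \<union> Z'" using ys Y by blast
          have "\<exists>x \<in> Z. y \<in> Z \<and> x = y \<or> x \<in> Z' \<and> y \<in> Z'" using Z' Y by blast
          then obtain x where "x \<in> Z" "y \<in> Z \<and> x = y \<or> x \<in> Z' \<and> y \<in> Z'" by blast
          then have "x \<in> Z" "norm (x - y) \<le> D + 2 * \<mu>"
            using w Z Z'(1) unfolding width_le_def by blast+
          then show ?thesis by (auto simp: dist_norm)
        qed
        then show "near_cover (D + 2 * \<mu>) Z ys" using ys unfolding near_cover_def by auto
      qed
      then have "subdivides (D + 2 * \<mu>) zs (concat yss)" unfolding subdivides_def by blast
      from subdivides_trans[OF zs(2) this] show ?thesis by (simp add: algebra_simps)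
    qed
    show "width_le f (2 * w + 4 * \<mu>) (concat yss)" if f: "subnorm f" and w: "width_le f w xs" for f w
    proof -
      have wz: "f (x - y) \<le> w + 2 * \<mu>" if "Z \<in> set zs" "x \<in> Z" "y \<in> Z" for Z x y
        using zs(3)[OF f w] that unfolding width_le_def by blast
      have "f (x - y) \<le> 2 * w + 4 * \<mu>" if Y: "Y \<in> set (concat yss)" "x \<in> Y" "y \<in> Y" for Y x y
      proof -
        obtain ys where ys: "ys \<in> set yss" "Y \<in> set ys" using Y(1) by auto
        from list_all2_set2[OF yss(1) ys(1)] ys(2)
        obtain Z where "Z \<in> set zs" "\<exists>Z' \<in> set zs. Z \<inter> Z' \<noteq> {} \<and> Y \<subseteq> Z \<union> Z'"
          by (elim bexE conjE) (drule (1) bspec, rule that)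
        then obtain Z' q where Z: "Z \<in> set zs" "Z' \<in> set zs" "q \<in> Z" "q \<in> Z'" "Y \<subseteq> Z \<union> Z'" by blast
        have "f (x - q) \<le> w + 2 * \<mu>" "f (q - y) \<le> w + 2 * \<mu>"
        proof -
          have "x \<in> Z \<or> x \<in> Z'" using Y(2) Z(5) by blast
          then show "f (x - q) \<le> w + 2 * \<mu>" using wz Z by metis
          have "y \<in> Z \<or> y \<in> Z'" using Y(3) Z(5) by blast
          then show "f (q - y) \<le> w + 2 * \<mu>" using wz Z by metis
        qed
        moreover have "f ((x - q) + (q - y)) \<le> f (x - q) + f (q - y)"
          using f unfolding subnorm_def by blast
        ultimately show ?thesis by simp
      qed
      then show ?thesis unfolding width_le_def by blast
    qed
  qed
qed

lemma tiling_rev: "tiling T xs \<Longrightarrow> tiling T (rev xs)"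
  by (simp add: tiling_def convex_blocks_rev)

lemma width_le_rev [simp]: "width_le f w (rev xs) = width_le f w xs"
  by (simp add: width_le_def)

lemma width_le_mono: "width_le f w xs \<Longrightarrow> w \<le> w' \<Longrightarrow> width_le f w' xs"
  unfolding width_le_def by (meson order_trans)

text \<open>The first pass starts from the trivial growth bound \<open>R\<close> and makes the
  shrinking steps small. Reversal turns these into the growing steps, so the second pass leaves both
  kinds small. Two passes multiply the widths by four.\<close>

lemma localise_steps:
  fixes T :: "'a::euclidean_space set"
  assumes T: "convex T" "closed T" "bounded T" and xs: "tiling T xs" and pos: "\<theta> > 0" "\<mu> > 0"
  obtains ys where "tiling T ys"
    "successively (\<lambda>X Y. \<exists>c. (X - Y) \<union> (Y - X) \<subseteq> cball c \<theta>) ys"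
    "\<And>D. width_le norm D xs \<Longrightarrow> subdivides (3 * D + 10 * \<mu>) xs ys"
    "\<And>f w. subnorm f \<Longrightarrow> width_le f w xs \<Longrightarrow> width_le f (4 * w + 12 * \<mu>) ys"
proof -
  obtain R where R: "R > 0" "\<And>x. x \<in> T \<Longrightarrow> norm x \<le> R" using T(3) by (auto simp: bounded_pos)
  \<comment> \<open>The growth radius after the second pass is \<open>\<theta>/2 + \<nu>\<close>,
    which must not exceed \<open>\<theta>\<close>.\<close>
  define \<nu> where "\<nu> = min \<mu> (\<theta> / 2)"
  have \<nu>: "\<nu> > 0" "\<nu> \<le> \<mu>" "\<nu> \<le> \<theta> / 2" using pos by (auto simp: \<nu>_def)
  have R': "Y \<subseteq> cball 0 R" if "Y \<in> set xs" for Y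
  proof -
    have "Y \<subseteq> T" using xs that by (simp add: tiling_def)
    then show ?thesis using R(2) by (simp add: subset_iff)
  qed
  have up: "successively (\<lambda>X Y. \<exists>c. Y - X \<subseteq> cball c R) xs"
    unfolding successively_conv_nth using R' by (meson Diff_subset nth_mem order_trans)
  obtain ys where ys: "tiling T ys" "successively (small_step (\<theta>/2) (R + \<nu>)) ys"
    "\<And>D. width_le norm D xs \<Longrightarrow> subdivides (D + 3 * \<nu>) xs ys"
    "\<And>f w. subnorm f \<Longrightarrow> width_le f w xs \<Longrightarrow> width_le f (2 * w + 4 * \<nu>) ys"
    using localise_growth[OF T xs _ _ \<nu>(1) up, of "\<theta>/2"] pos R by auto
  have up': "successively (\<lambda>X Y. \<exists>c. Y - X \<subseteq> cball c (\<theta>/2)) (rev ys)"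
    unfolding successively_rev using ys(2)
    by (rule successively_mono) (use pos in \<open>auto simp: small_step_def\<close>)
  obtain zs where zs: "tiling T zs" "successively (small_step \<theta> (\<theta>/2 + \<nu>)) zs"
    "\<And>D. width_le norm D (rev ys) \<Longrightarrow> subdivides (D + 3 * \<nu>) (rev ys) zs"
    "\<And>f w. subnorm f \<Longrightarrow> width_le f w (rev ys) \<Longrightarrow> width_le f (2 * w + 4 * \<nu>) zs"
    using localise_growth[OF T tiling_rev[OF ys(1)] pos(1) _ \<nu>(1) up'] pos by auto
  show thesis
  proof
    show "tiling T (rev zs)" using zs(1) by (rule tiling_rev)
    show "successively (\<lambda>X Y. \<exists>c. (X - Y) \<union> (Y - X) \<subseteq> cball c \<theta>) (rev zs)"
      unfolding successively_rev using zs(2)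
    proof (rule successively_mono)
      fix X Y :: "'a set" assume "small_step \<theta> (\<theta>/2 + \<nu>) X Y"
      moreover have *: "cball c (\<theta>/2 + \<nu>) \<subseteq> cball c \<theta>" for c :: 'a using \<nu> by (intro subset_cball) simp
      ultimately show "\<exists>c. (Y - X) \<union> (X - Y) \<subseteq> cball c \<theta>"
        unfolding small_step_def
      proof (elim disjE conjE exE)
        fix c assume "Y \<subseteq> X" "X - Y \<subseteq> cball c \<theta>"
        then show ?thesis by (intro exI[of _ c]) blast
      next
        fix c assume "X \<subseteq> Y" "Y - X \<subseteq> cball c (\<theta>/2 + \<nu>)"
        then show ?thesis using *[of c] by (intro exI[of _ c]) blast
      qed
    qed
    show "subdivides (3 * D + 10 * \<mu>) xs (rev zs)" if D: "width_le norm D xs" for D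
    proof -
      have "subdivides ((2 * D + 4 * \<nu>) + 3 * \<nu>) (rev ys) zs"
        by (rule zs(3)) (simp add: ys(4)[OF subnorm_norm D])
      from subdivides_rev[OF this] have "subdivides ((2 * D + 4 * \<nu>) + 3 * \<nu>) ys (rev zs)" by simp
      from subdivides_trans[OF ys(3)[OF D] this]
      show ?thesis by (rule subdivides_mono) (use \<nu> in simp)
    qed
    show "width_le f (4 * w + 12 * \<mu>) (rev zs)" if f: "subnorm f" and w: "width_le f w xs" for f w
    proof -
      have "width_le f (2 * (2 * w + 4 * \<nu>) + 4 * \<nu>) zs"
        by (rule zs(4)[OF f]) (simp add: ys(4)[OF f w])
      moreover have "2 * (2 * w + 4 * \<nu>) + 4 * \<nu> \<le> 4 * w + 12 * \<mu>" using \<nu> by simp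
      ultimately show ?thesis unfolding width_le_rev by (rule width_le_mono)
    qed
  qed
qed

section \<open>Cutting into strips\<close>

text \<open>Neighbouring strips overlap by half, so that every ball of radius \<open>\<theta>\<close> lies in one of them.\<close>

definition strip :: "real \<Rightarrow> 'a::real_inner \<Rightarrow> int \<Rightarrow> 'a set" where
  "strip \<theta> e j = {x. x \<bullet> e \<in> {2 * of_int j * \<theta>..(2 * of_int j + 4) * \<theta>}}"

text \<open>A walk through pairs of a tile and a strip, moving in one component at a time. That a
  tile changes only inside the current strip makes cutting compatible with unions along the
  walk.\<close>

definition strip_step :: "real \<Rightarrow> 'a::real_inner \<Rightarrow> 'a set \<times> int \<Rightarrow> 'a set \<times> int \<Rightarrow> bool" where
  "strip_step \<theta> e p q \<longleftrightarrow> fst p = fst q \<and> \<bar>snd p - snd q\<bar> \<le> 1 \<or>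
     snd p = snd q \<and> (fst p - fst q) \<union> (fst q - fst p) \<subseteq> strip \<theta> e (snd p)"

lemma strip_step_change:
  assumes "successively (strip_step \<theta> e) ps"
    and "\<exists>p \<in> set ps. z \<in> fst p" "\<exists>p \<in> set ps. z \<notin> fst p"
  shows "\<exists>p \<in> set ps. z \<in> fst p \<inter> strip \<theta> e (snd p)"
  using assms
proof (induction ps)
  case (Cons p ps)
  show ?case
  proof (cases "(\<exists>q \<in> set ps. z \<in> fst q) \<and> (\<exists>q \<in> set ps. z \<notin> fst q)")
    case True
    then show ?thesis using Cons.IH Cons.prems(1) by (auto simp: successively_Cons)
  next
    case False
    show ?thesis
    proof (cases ps)
      case Nil
      then show ?thesis using Cons.prems(2,3) by auto
    next
      case (Cons q ps')
      have "z \<in> fst p \<longleftrightarrow> z \<notin> fst q"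
        using False Cons.prems(2,3) Cons by auto
      moreover have "strip_step \<theta> e p q" using Cons.prems(1) Cons by simp
      ultimately show ?thesis using Cons unfolding strip_step_def by auto
    qed
  qed
qed auto

text \<open>
  A point \<open>z\<close> of a visited strip and of some visited tile lies in a visited piece: otherwise the tile present
  while visiting that strip misses \<open>z\<close>, so \<open>z\<close> enters or leaves the tile somewhere along the path,
  and this happens in a strip containing \<open>z\<close>.
\<close>

lemma strip_block_union:
  assumes "successively (strip_step \<theta> e) ps"
  shows "(\<Union>p \<in> set ps. fst p \<inter> strip \<theta> e (snd p)) = (\<Union>p \<in> set ps. fst p) \<inter> (\<Union>p \<in> set ps. strip \<theta> e (snd p))"
proof
  show "(\<Union>p \<in> set ps. fst p) \<inter> (\<Union>p \<in> set ps. strip \<theta> e (snd p)) \<subseteq> (\<Union>p \<in> set ps. fst p \<inter> strip \<theta> e (snd p))"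
  proof
    fix z assume "z \<in> (\<Union>p \<in> set ps. fst p) \<inter> (\<Union>p \<in> set ps. strip \<theta> e (snd p))"
    then obtain p q where pq: "p \<in> set ps" "z \<in> fst p" "q \<in> set ps" "z \<in> strip \<theta> e (snd q)" by auto
    show "z \<in> (\<Union>p \<in> set ps. fst p \<inter> strip \<theta> e (snd p))"
    proof (cases "z \<in> fst q")
      case False
      then show ?thesis using strip_step_change[OF assms, of z] pq by blast
    qed (use pq in blast)
  qed
qed blast

text \<open>In the direction \<open>e\<close> the strips are intervals, and neighbouring ones
  overlap. Their union along a walk is connected, hence a convex set of reals, and its linear
  preimage is convex.\<close>

lemma convex_strip_union:
  assumes "successively (strip_step \<theta> e) ps" "\<theta> > 0"
  shows "convex (\<Union>p \<in> set ps. strip \<theta> e (snd p))"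
proof -
  define I where "I j = {2 * real_of_int j * \<theta>..(2 * real_of_int j + 4) * \<theta>}" for j
  have meet: "I i \<inter> I j \<noteq> {}" if "\<bar>i - j\<bar> \<le> 1" for i j
  proof -
    have "2 * real_of_int (max i j) * \<theta> \<in> I i \<inter> I j"
      using that assms(2) by (auto simp: I_def max_def intro!: mult_right_mono)
    then show ?thesis by blast
  qed
  have "connected (\<Union>p \<in> set ps. I (snd p))"
    using assms(1)
  proof (induction ps)
    case (Cons p ps)
    show ?case
    proof (cases ps)
      case Nil
      then show ?thesis by (simp add: I_def)
    next
      case (Cons q ps')
      then have "strip_step \<theta> e p q" using Cons.prems by simp
      then have "\<bar>snd p - snd q\<bar> \<le> 1" by (auto simp: strip_step_def)
      then have "I (snd p) \<inter> (\<Union>p \<in> set ps. I (snd p)) \<noteq> {}"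
        using meet[of "snd p" "snd q"] Cons by auto
      moreover have "successively (strip_step \<theta> e) ps" using Cons.prems by (simp add: Cons)
      then have "connected (\<Union>p \<in> set ps. I (snd p))" by (rule Cons.IH)
      moreover have "connected (I (snd p))" by (simp add: I_def)
      ultimately have "connected (I (snd p) \<union> (\<Union>p \<in> set ps. I (snd p)))"
        by (intro connected_Un)
      then show ?thesis by simp
    qed
  qed auto
  then have "convex (\<Union>p \<in> set ps. I (snd p))" 
    using is_interval_connected_1 is_interval_convex_1 by blast
  then have "convex ((\<lambda>x. x \<bullet> e) -` (\<Union>p \<in> set ps. I (snd p)))"
    by (intro convex_linear_vimage bounded_linear.linear bounded_linear_inner_left)
  moreover have "(\<lambda>x. x \<bullet> e) -` (\<Union>p \<in> set ps. I (snd p)) = (\<Union>p \<in> set ps. strip \<theta> e (snd p))"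
    unfolding I_def strip_def by blast
  ultimately show ?thesis by simp
qed

lemma successively_upto: "successively (\<lambda>i j. \<bar>i - j\<bar> \<le> 1) [m..n]"
  by (auto simp: successively_conv_nth nth_upto)

lemma integer_walk:
  fixes j0 j1 J :: int
  obtains js where "js \<noteq> []" "hd js = j0" "last js = j1" "{-J..J} \<subseteq> set js"
    "successively (\<lambda>i j. \<bar>i - j\<bar> \<le> 1) js"
proof -
  define m M where "m = min (-J) (min j0 j1)" and "M = max J (max j0 j1)"
  have mM: "m \<le> j0" "m \<le> M" "j1 \<le> M" "m \<le> -J" "J \<le> M" by (auto simp: m_def M_def)
  have hd_upto: "hd [a..b] = a" and last_upto: "last [a..b] = b" and ne: "[a..b] \<noteq> []" if "a \<le> b" for a b :: int
  proof -
    show "hd [a..b] = a" using that by (simp add: upto_rec1)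
    show "last [a..b] = b" using that by (simp add: upto_rec2)
    show "[a..b] \<noteq> []" using that by simp
  qed
  \<comment> \<open>Down to \<open>m\<close>, up to \<open>M\<close>, down to \<open>j1\<close>; the
    turning points occur twice, which the bound on successive differences allows.\<close>
  define js where "js = rev [m..j0] @ [m..M] @ rev [j1..M]"
  have "successively (\<lambda>i j. \<bar>j - i\<bar> \<le> 1) [a..b]" for a b :: int
    using successively_upto by (rule successively_mono) simp
  then have "successively (\<lambda>i j. \<bar>i - j\<bar> \<le> 1) js"
    unfolding js_def successively_append_iff successively_rev
    using mM by (simp add: hd_append hd_rev last_rev hd_upto last_upto successively_upto)
  moreover have "hd js = j0" "last js = j1" "js \<noteq> []"
    using mM by (simp_all add: js_def hd_append hd_rev last_rev hd_upto last_upto)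
  moreover have "{-J..J} \<subseteq> set js" using mM by (auto simp: js_def)
  ultimately show thesis using that by blast
qed

text \<open>The starting strip \<open>j0\<close> is arbitrary because the walk through
  \<open>V\<close> has to end in the strip \<open>j1\<close> where \<open>V\<close> and its
  successor differ, and the remaining path has to start there. Visiting all of
  \<open>{-J..J}\<close> lets the pieces of a tile cover it.\<close>

lemma strip_path:
  assumes "vs \<noteq> []" and "successively (\<lambda>V W. \<exists>j. (V - W) \<union> (W - V) \<subseteq> strip \<theta> e j) vs"
  shows "\<exists>pss. list_all2 (\<lambda>V ps. fst ` set ps = {V} \<and> {-J..J} \<subseteq> snd ` set ps) vs pss \<and>
    successively (strip_step \<theta> e) (concat pss) \<and> concat pss \<noteq> [] \<and> hd (concat pss) = (hd vs, j0)"
  using assms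
proof (induction vs arbitrary: j0 rule: list_nonempty_induct)
  case (single V)
  obtain js where js: "js \<noteq> []" "hd js = j0" "last js = j0" "{-J..J} \<subseteq> set js"
    "successively (\<lambda>i j. \<bar>i - j\<bar> \<le> 1) js" by (rule integer_walk)
  have "successively (strip_step \<theta> e) (map (Pair V) js)"
    unfolding successively_map using js(5) by (rule successively_mono) (simp add: strip_step_def)
  then show ?case
    using js by (intro exI[of _ "[map (Pair V) js]"]) (auto simp: hd_map image_image image_constant_conv)
next
  case (cons V vs)
  obtain W vs' where vs: "vs = W # vs'" using cons.hyps by (cases vs) auto
  obtain j1 where j1: "(V - W) \<union> (W - V) \<subseteq> strip \<theta> e j1" using cons.prems vs by auto
  obtain pss where pss: "list_all2 (\<lambda>V ps. fst ` set ps = {V} \<and> {-J..J} \<subseteq> snd ` set ps) vs pss"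
    "successively (strip_step \<theta> e) (concat pss)" "concat pss \<noteq> []" "hd (concat pss) = (W, j1)"
    using cons.IH[of j1] cons.prems vs by auto
  obtain js where js: "js \<noteq> []" "hd js = j0" "last js = j1" "{-J..J} \<subseteq> set js"
    "successively (\<lambda>i j. \<bar>i - j\<bar> \<le> 1) js" by (rule integer_walk)
  have "successively (strip_step \<theta> e) (map (Pair V) js)"
    unfolding successively_map using js(5) by (rule successively_mono) (simp add: strip_step_def)
  moreover have "strip_step \<theta> e (last (map (Pair V) js)) (hd (concat pss))"
    using js(1,3) j1 pss(4) by (simp add: strip_step_def last_map)
  ultimately have "successively (strip_step \<theta> e) (map (Pair V) js @ concat pss)"
    using pss(2) by (simp add: successively_append_iff)
  moreover have "fst ` set (map (Pair V) js) = {V} \<and> {-J..J} \<subseteq> snd ` set (map (Pair V) js)"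
    using js by (auto simp: image_image image_constant_conv)
  ultimately show ?case
    using js pss(1) by (intro exI[of _ "map (Pair V) js # pss"]) (simp add: hd_append hd_map)
qed

lemma strip_tiling:
  fixes T :: "'a::euclidean_space set"
  assumes T: "bounded T" and vs: "tiling T vs" and e: "norm e = 1" and \<theta>: "\<theta> > 0"
    and local: "successively (\<lambda>X Y. \<exists>c. (X - Y) \<union> (Y - X) \<subseteq> cball c \<theta>) vs"
  obtains ys where "tiling T ys" "subdivides 0 vs ys" "width_le (\<lambda>x. \<bar>x \<bullet> e\<bar>) (4 * \<theta>) ys"
    "\<And>f w. width_le f w vs \<Longrightarrow> width_le f w ys"
proof -
  obtain R where R: "R > 0" "\<And>x. x \<in> T \<Longrightarrow> norm x \<le> R" using T by (auto simp: bounded_pos)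
  have inner_le: "\<bar>x \<bullet> e\<bar> \<le> norm x" for x using Cauchy_Schwarz_ineq2[of x e] e by simp
  \<comment> \<open>The inner product of a point of \<open>T\<close> with the unit vector
    \<open>e\<close> is at most \<open>R\<close> in absolute value, so the strips from
    \<open>-J\<close> to \<open>J\<close> cover \<open>T\<close>.\<close>
  define J where "J = \<lceil>R / (2 * \<theta>)\<rceil>"
  have cover: "\<exists>j \<in> {-J..J}. x \<in> strip \<theta> e j" if "x \<in> T" for x
  proof
    define j where "j = \<lfloor>x \<bullet> e / (2 * \<theta>)\<rfloor>"
    have "real_of_int j \<le> x \<bullet> e / (2 * \<theta>)" "x \<bullet> e / (2 * \<theta>) < real_of_int j + 1"
      unfolding j_def by linarith+
    then have "2 * real_of_int j * \<theta> \<le> x \<bullet> e" "x \<bullet> e \<le> (2 * real_of_int j + 4) * \<theta>"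
      using \<theta> by (auto simp: field_simps)
    then show "x \<in> strip \<theta> e j" by (simp add: strip_def)
    have "\<bar>x \<bullet> e\<bar> \<le> R" using inner_le[of x] R(2)[OF that] by linarith
    then have "-(R / (2 * \<theta>)) \<le> x \<bullet> e / (2 * \<theta>)" "x \<bullet> e / (2 * \<theta>) \<le> R / (2 * \<theta>)"
      using \<theta> by (auto simp: field_simps)
    then show "j \<in> {-J..J}" unfolding j_def J_def by (auto simp: le_floor_iff) linarith+
  qed
  have ball: "\<exists>j. cball c \<theta> \<subseteq> strip \<theta> e j" for c
  proof (intro exI subsetI)
    fix x assume x: "x \<in> cball c \<theta>"
    \<comment> \<open>Strips have width \<open>4 * \<theta>\<close> and start at the multiples of
      \<open>2 * \<theta>\<close>. The last start not beyond the beginning of the ball leaves room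
      for its diameter.\<close>
    define j where "j = \<lfloor>(c \<bullet> e - \<theta>) / (2 * \<theta>)\<rfloor>"
    have "real_of_int j \<le> (c \<bullet> e - \<theta>) / (2 * \<theta>)" "(c \<bullet> e - \<theta>) / (2 * \<theta>) < real_of_int j + 1"
      unfolding j_def by linarith+
    then have "2 * real_of_int j * \<theta> \<le> c \<bullet> e - \<theta>" "c \<bullet> e + \<theta> \<le> (2 * real_of_int j + 4) * \<theta>"
      using \<theta> by (auto simp: field_simps)
    moreover have "\<bar>x \<bullet> e - c \<bullet> e\<bar> \<le> \<theta>"
      using inner_le[of "x - c"] x by (simp add: inner_diff_left dist_norm norm_minus_commute)
    ultimately show "x \<in> strip \<theta> e \<lfloor>(c \<bullet> e - \<theta>) / (2 * \<theta>)\<rfloor>" unfolding j_def[symmetric] by (auto simp: strip_def abs_le_iff)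
  qed
  have "successively (\<lambda>V W. \<exists>j. (V - W) \<union> (W - V) \<subseteq> strip \<theta> e j) vs"
    using local
  proof (rule successively_mono)
    fix X Y :: "'a set" assume "\<exists>c. (X - Y) \<union> (Y - X) \<subseteq> cball c \<theta>"
    then show "\<exists>j. (X - Y) \<union> (Y - X) \<subseteq> strip \<theta> e j" using ball by (meson subset_trans)
  qed
  then obtain pss where pss: "list_all2 (\<lambda>V ps. fst ` set ps = {V} \<and> {-J..J} \<subseteq> snd ` set ps) vs pss"
    "successively (strip_step \<theta> e) (concat pss)" "concat pss \<noteq> []"
    using strip_path[of vs \<theta> e J 0] vs by (auto simp: tiling_def)
  define cut where "cut = (\<lambda>p. fst p \<inter> strip \<theta> e (snd p))"
  \<comment> \<open>The walk also visits strips that miss the current tile; dropping the empty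
    pieces does not affect the blocks.\<close>
  define ys where "ys = filter (\<lambda>X. X \<noteq> {}) (map cut (concat pss))"
  have fsts: "convex_blocks (map fst (concat pss))"
  proof -
    \<comment> \<open>Forgetting the strips turns the walk into \<open>vs\<close> with repeated
      entries, so convexity of its blocks is inherited.\<close>
    have "list_all2 (\<lambda>V rs. set rs = {V}) vs (map (map fst) pss)"
      unfolding list.rel_map using pss(1) by (rule list_all2_mono) simp
    then have "block_equiv (concat (map (map fst) pss)) vs" by (rule block_equiv_concat_constant)
    then show ?thesis using vs by (simp add: map_concat block_equiv_def tiling_def)
  qed
  have blocks: "convex_blocks (map cut (concat pss))"
    unfolding convex_blocks_def
  proof (intro allI impI)
    fix us bs ws assume "map cut (concat pss) = us @ bs @ ws"
    then obtain us' bs' ws' where bs: "concat pss = us' @ bs' @ ws'" "map cut bs' = bs"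
      by (rule map_eq_append3)
    have path: "successively (strip_step \<theta> e) bs'"
      using pss(2) unfolding bs(1) successively_append_iff by blast
    have "map fst (concat pss) = map fst us' @ map fst bs' @ map fst ws'" by (simp add: bs(1))
    then have "convex (\<Union> (set (map fst bs')))" using fsts unfolding convex_blocks_def by blast
    then have "convex ((\<Union>p \<in> set bs'. fst p) \<inter> (\<Union>p \<in> set bs'. strip \<theta> e (snd p)))"
      using convex_strip_union[OF path \<theta>] by (simp add: convex_Int)
    then show "convex (\<Union> (set bs))"
      unfolding strip_block_union[OF path, symmetric] bs(2)[symmetric] by (simp add: cut_def)
  qed
  have fst_in: "fst p \<in> set vs" if p: "p \<in> set (concat pss)" for p
  proof -
    obtain ps where ps: "ps \<in> set pss" "p \<in> set ps" using p by auto
    from list_all2_set2[OF pss(1) ps(1)] obtain V where V: "V \<in> set vs" "fst ` set ps = {V}"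
      by (elim bexE conjE) (rule that)
    then have "fst p = V" using ps(2) by blast
    then show ?thesis using V(1) by simp
  qed
  have mem: "\<exists>p \<in> set (concat pss). Y = cut p \<and> fst p \<in> set vs" if Y: "Y \<in> set ys" for Y
  proof -
    have "Y \<in> cut ` set (concat pss)" using Y unfolding ys_def by simp
    then obtain p where "p \<in> set (concat pss)" "Y = cut p" by (elim imageE) (rule that)
    then show ?thesis using fst_in by blast
  qed
  have ref: "list_all2 (near_cover 0) vs (map (\<lambda>ps. filter (\<lambda>X. X \<noteq> {}) (map cut ps)) pss)"
    unfolding list.rel_map
  proof (rule list.rel_mono_strong[OF pss(1)])
    fix V ps assume V: "V \<in> set vs" and ps: "fst ` set ps = {V} \<and> {-J..J} \<subseteq> snd ` set ps"
    have VT: "V \<subseteq> T" "V \<noteq> {}" using V vs by (auto simp: tiling_def)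
    have sub: "V \<subseteq> \<Union> (set (filter (\<lambda>X. X \<noteq> {}) (map cut ps)))"
    proof
      fix x assume x: "x \<in> V"
      then obtain j where j: "j \<in> {-J..J}" "x \<in> strip \<theta> e j" using cover VT by blast
      then obtain p where p: "p \<in> set ps" "snd p = j" using ps by (metis imageE subsetD)
      then have "fst p = V" using ps by blast
      then have "x \<in> cut p" using x j p by (simp add: cut_def)
      then show "x \<in> \<Union> (set (filter (\<lambda>X. X \<noteq> {}) (map cut ps)))" using p by auto
    qed
    moreover have "\<exists>x \<in> V. dist x y \<le> 0" if "Y \<in> set (filter (\<lambda>X. X \<noteq> {}) (map cut ps))" "y \<in> Y" for Y y
    proof -
      from that obtain p where "p \<in> set ps" "y \<in> fst p" by (auto simp: cut_def)
      then have "y \<in> V" using ps by blast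
      then show ?thesis by (intro bexI[of _ y]) auto
    qed
    moreover have "filter (\<lambda>X. X \<noteq> {}) (map cut ps) \<noteq> []"
    proof
      assume "filter (\<lambda>X. X \<noteq> {}) (map cut ps) = []"
      then show False using sub VT(2) by (metis Union_empty empty_set subset_empty)
    qed
    ultimately show "near_cover 0 V (filter (\<lambda>X. X \<noteq> {}) (map cut ps))" unfolding near_cover_def by blast
  qed
  have ys_concat: "ys = concat (map (\<lambda>ps. filter (\<lambda>X. X \<noteq> {}) (map cut ps)) pss)"
    by (simp add: ys_def map_concat filter_concat o_def)
  show thesis
  proof
    show ref': "subdivides 0 vs ys" unfolding subdivides_def ys_concat using ref by blast
    show "tiling T ys"
      unfolding tiling_def
    proof (intro conjI ballI)
      show "convex_blocks ys"
        using blocks block_equiv_filter unfolding ys_def block_equiv_def by blast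
      show "ys \<noteq> []"
      proof -
        obtain V vs' where "vs = V # vs'" using vs by (cases vs) (auto simp: tiling_def)
        then show ?thesis using ref unfolding ys_concat by (auto simp: list_all2_Cons1 near_cover_def)
      qed
      fix Y assume Y: "Y \<in> set ys"
      then show "Y \<noteq> {}" by (simp add: ys_def)
      from mem[OF Y] obtain p where p: "Y = cut p" "fst p \<in> set vs" by blast
      then have "closed (fst p)" "fst p \<subseteq> T" using vs by (auto simp: tiling_def)
      moreover have "closed (strip \<theta> e (snd p))"
        unfolding strip_def atLeastAtMost_iff
        by (intro closed_Collect_conj closed_Collect_le continuous_intros)
      ultimately show "closed Y" "Y \<subseteq> T" by (auto simp: p(1) cut_def)
    qed
    show "width_le (\<lambda>x. \<bar>x \<bullet> e\<bar>) (4 * \<theta>) ys"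
      unfolding width_le_def
    proof (intro ballI)
      fix Y x y assume "Y \<in> set ys" "x \<in> Y" "y \<in> Y"
      with mem[of Y] obtain p where "x \<in> cut p" "y \<in> cut p" by blast
      then show "\<bar>(x - y) \<bullet> e\<bar> \<le> 4 * \<theta>"
        by (auto simp: cut_def strip_def inner_diff_left algebra_simps)
    qed
    show "width_le f w ys" if "width_le f w vs" for f w
      unfolding width_le_def
    proof (intro ballI)
      fix Y x y assume "Y \<in> set ys" "x \<in> Y" "y \<in> Y"
      with mem[of Y] obtain p where "fst p \<in> set vs" "x \<in> fst p" "y \<in> fst p" by (auto simp: cut_def)
      then show "f (x - y) \<le> w" using that unfolding width_le_def by blast
    qed
  qed
qed

section \<open>Tiles of small diameter\<close>

lemma thin_direction:
  fixes T :: "'a::euclidean_space set"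
  assumes T: "convex T" "closed T" "bounded T" and xs: "tiling T xs" and e: "norm e = 1"
    and pos: "w > 0" "\<mu> > 0"
  obtains ys where "tiling T ys" "width_le (\<lambda>x. \<bar>x \<bullet> e\<bar>) w ys"
    "\<And>D. width_le norm D xs \<Longrightarrow> subdivides (3 * D + 10 * \<mu>) xs ys"
    "\<And>f w. subnorm f \<Longrightarrow> width_le f w xs \<Longrightarrow> width_le f (4 * w + 12 * \<mu>) ys"
proof -
  have w4: "w / 4 > 0" using pos by simp
  obtain vs where vs: "tiling T vs"
    "successively (\<lambda>X Y. \<exists>c. (X - Y) \<union> (Y - X) \<subseteq> cball c (w / 4)) vs"
    "\<And>D. width_le norm D xs \<Longrightarrow> subdivides (3 * D + 10 * \<mu>) xs vs"
    "\<And>f w. subnorm f \<Longrightarrow> width_le f w xs \<Longrightarrow> width_le f (4 * w + 12 * \<mu>) vs"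
    by (rule localise_steps[OF T xs w4 pos(2)]) (rule that)
  obtain ys where ys: "tiling T ys" "subdivides 0 vs ys" "width_le (\<lambda>x. \<bar>x \<bullet> e\<bar>) (4 * (w / 4)) ys"
    "\<And>f w. width_le f w vs \<Longrightarrow> width_le f w ys"
    by (rule strip_tiling[OF T(3) vs(1) e w4 vs(2)]) (rule that)
  show thesis
  proof
    show "tiling T ys" by (rule ys(1))
    show "width_le (\<lambda>x. \<bar>x \<bullet> e\<bar>) w ys" using ys(3) by simp
    show "subdivides (3 * D + 10 * \<mu>) xs ys" if "width_le norm D xs" for D
      using subdivides_trans[OF vs(3)[OF that] ys(2)] by simp
    show "width_le f (4 * w + 12 * \<mu>) ys" if "subnorm f" "width_le f w xs" for f w
      by (rule ys(4)[OF vs(4)[OF that]])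
  qed
qed

lemma subdivides_refl: "0 \<le> r \<Longrightarrow> subdivides r xs xs"
  using subdivides_map[of xs id r] by force

text \<open>The point is the order of the quantifiers: \<open>C\<close> is fixed before the list,
  \<open>D\<close> and \<open>w\<close>. Treating a new direction spoils the widths in the earlier
  ones only by a fixed factor and a small summand, so those are made thinner beforehand.\<close>

lemma thin_directions:
  fixes T :: "'a::euclidean_space set"
  assumes T: "convex T" "closed T" "bounded T" and B: "finite B" "B \<subseteq> Basis"
  shows "\<exists>C \<ge> 1. \<forall>xs D w. tiling T xs \<longrightarrow> width_le norm D xs \<longrightarrow> 0 < w \<longrightarrow> w \<le> D \<longrightarrow>
    (\<exists>ys. tiling T ys \<and> subdivides (C * D) xs ys \<and> width_le norm (C * D) ys \<and>
      (\<forall>b \<in> B. width_le (\<lambda>x. \<bar>x \<bullet> b\<bar>) w ys))"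
  using B
proof (induction B)
  case empty
  have "subdivides D xs xs" if "0 < w" "w \<le> D" for xs :: "'a set list" and D w :: real
    using that by (intro subdivides_refl) auto
  then show ?case by (intro exI[of _ 1]) auto
next
  case (insert b B)
  then obtain C where C: "C \<ge> 1" and IH: "\<And>xs D w. tiling T xs \<Longrightarrow> width_le norm D xs \<Longrightarrow> 0 < w \<Longrightarrow> w \<le> D \<Longrightarrow>
    (\<exists>ys. tiling T ys \<and> subdivides (C * D) xs ys \<and> width_le norm (C * D) ys \<and>
      (\<forall>b \<in> B. width_le (\<lambda>x. \<bar>x \<bullet> b\<bar>) w ys))" by auto
  have b: "norm b = 1" using insert by simp
  show ?case
  proof (intro exI[of _ "4 * C + 1"] conjI allI impI)
    show "1 \<le> 4 * C + 1" using C by simp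
    fix xs :: "'a set list" and D w :: real
    assume xs: "tiling T xs" "width_le norm D xs" and w: "0 < w" "w \<le> D"
    \<comment> \<open>The new direction turns a width \<open>v\<close> into
      \<open>4 * v + 12 * (w / 24)\<close>, and \<open>v = w / 8\<close> gives exactly
      \<open>w\<close>.\<close>
    have w8: "0 < w / 8" "w / 8 \<le> D" and w24: "0 < w / 24" using w by auto
    from IH[OF xs w8] obtain ys where ys: "tiling T ys" "subdivides (C * D) xs ys"
      "width_le norm (C * D) ys" "\<forall>b \<in> B. width_le (\<lambda>x. \<bar>x \<bullet> b\<bar>) (w / 8) ys" by blast
    obtain zs where zs: "tiling T zs" "width_le (\<lambda>x. \<bar>x \<bullet> b\<bar>) w zs"
      "\<And>D. width_le norm D ys \<Longrightarrow> subdivides (3 * D + 10 * (w / 24)) ys zs"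
      "\<And>f v. subnorm f \<Longrightarrow> width_le f v ys \<Longrightarrow> width_le f (4 * v + 12 * (w / 24)) zs"
      by (rule thin_direction[OF T ys(1) b w(1) w24]) (rule that)
    have "subdivides (C * D + (3 * (C * D) + 10 * (w / 24))) xs zs"
      by (rule subdivides_trans[OF ys(2) zs(3)[OF ys(3)]])
    then have "subdivides ((4 * C + 1) * D) xs zs"
      by (rule subdivides_mono) (use w in \<open>simp add: algebra_simps\<close>)
    moreover have "width_le norm ((4 * C + 1) * D) zs"
      by (rule width_le_mono[OF zs(4)[OF subnorm_norm ys(3)]]) (use w in \<open>simp add: algebra_simps\<close>)
    moreover have "width_le (\<lambda>x. \<bar>x \<bullet> b'\<bar>) w zs" if "b' \<in> insert b B" for b'
    proof (cases "b' = b")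
      case False
      then have b': "b' \<in> B" using that by simp
      have "subnorm (\<lambda>x. \<bar>x \<bullet> b'\<bar>)"
        using insert.prems b' by (auto simp: subnorm_def inner_add_left Basis_le_norm)
      then have "width_le (\<lambda>x. \<bar>x \<bullet> b'\<bar>) (4 * (w / 8) + 12 * (w / 24)) zs"
        using ys(4) b' by (intro zs(4)) auto
      then show ?thesis by simp
    qed (use zs(2) in simp)
    ultimately show "\<exists>ys. tiling T ys \<and> subdivides ((4 * C + 1) * D) xs ys \<and>
      width_le norm ((4 * C + 1) * D) ys \<and> (\<forall>b \<in> insert b B. width_le (\<lambda>x. \<bar>x \<bullet> b\<bar>) w ys)"
      using zs(1) by blast
  qed
qed

text \<open>The ball is taken relative to \<open>T\<close>, so that the notion is meaningful even if
  \<open>T\<close> has empty interior.\<close>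

definition fat :: "'a::metric_space set \<Rightarrow> 'a set list \<Rightarrow> bool" where
  "fat T xs \<longleftrightarrow> (\<forall>X \<in> set xs. \<exists>y \<in> X. \<exists>r > 0. ball y r \<inter> T \<subseteq> X)"

text \<open>Width at most \<open>w\<close> in all coordinates bounds the diameter by
  \<open>real DIM('a) * w\<close>. This is set to \<open>\<delta> / 2\<close>, because a last
  swelling, which makes the tiles fat, adds another \<open>\<delta> / 2\<close>.\<close>

lemma fine_tiling:
  fixes T :: "'a::euclidean_space set"
  assumes T: "convex T" "closed T" "bounded T"
  obtains C where "C \<ge> 1" "\<And>xs D \<delta>. tiling T xs \<Longrightarrow> width_le norm D xs \<Longrightarrow> 0 < \<delta> \<Longrightarrow> \<delta> \<le> D \<Longrightarrow>
    \<exists>ys. tiling T ys \<and> subdivides (C * D) xs ys \<and> width_le norm \<delta> ys \<and> fat T ys"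
proof -
  obtain C where C: "C \<ge> 1" and step: "\<And>xs D w. tiling T xs \<Longrightarrow> width_le norm D xs \<Longrightarrow> 0 < w \<Longrightarrow> w \<le> D \<Longrightarrow>
    (\<exists>ys. tiling T ys \<and> subdivides (C * D) xs ys \<and> width_le norm (C * D) ys \<and>
      (\<forall>b \<in> Basis. width_le (\<lambda>x. \<bar>x \<bullet> b\<bar>) w ys))"
    using thin_directions[OF T finite_Basis order_refl] by auto
  show thesis
  proof (rule that[of "C + 1"])
    show "1 \<le> C + 1" using C by simp
    fix xs :: "'a set list" and D \<delta> :: real
    assume xs: "tiling T xs" "width_le norm D xs" and \<delta>: "0 < \<delta>" "\<delta> \<le> D"
    define w where "w = \<delta> / (2 * real DIM('a))"
    have dim: "real DIM('a) \<ge> 1" using DIM_positive[where 'a='a] by linarith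
    have "\<delta> * 1 \<le> \<delta> * (2 * real DIM('a))" using \<delta> dim by (intro mult_left_mono) linarith+
    then have "w \<le> \<delta>" unfolding w_def using \<delta> by (simp add: divide_le_eq)
    then have w: "0 < w" "w \<le> D" "real DIM('a) * w = \<delta> / 2"
      using \<delta> by (auto simp: w_def)
    from step[OF xs w(1,2)] obtain ys where ys: "tiling T ys" "subdivides (C * D) xs ys"
      "\<forall>b \<in> Basis. width_le (\<lambda>x. \<bar>x \<bullet> b\<bar>) w ys" by blast
    have ysw: "width_le norm (\<delta> / 2) ys"
      unfolding width_le_def
    proof (intro ballI)
      fix Y x y assume Y: "Y \<in> set ys" "x \<in> Y" "y \<in> Y"
      have "norm (x - y) \<le> (\<Sum>b\<in>Basis. \<bar>(x - y) \<bullet> b\<bar>)" by (rule norm_le_l1)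
      also have "\<dots> \<le> (\<Sum>b\<in>(Basis :: 'a set). w)"
        using ys(3) Y unfolding width_le_def by (intro sum_mono) blast
      finally show "norm (x - y) \<le> \<delta> / 2" using w(3) by simp
    qed
    have \<delta>4: "\<delta> / 4 > 0" using \<delta> by simp
    obtain zs where zs: "tiling T zs" "subdivides (\<delta> / 4) ys zs"
      "\<And>f w. subnorm f \<Longrightarrow> width_le f w ys \<Longrightarrow> width_le f (w + 2 * (\<delta> / 4)) zs"
      "\<And>Y. Y \<in> set zs \<Longrightarrow> \<exists>y \<in> Y. \<exists>r > 0. ball y r \<inter> T \<subseteq> Y"
      by (rule swell_list[OF T ys(1) \<delta>4]) (rule that)
    have "subdivides ((C + 1) * D) xs zs"
      by (rule subdivides_mono[OF subdivides_trans[OF ys(2) zs(2)]]) (use \<delta> in \<open>simp add: algebra_simps\<close>)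
    moreover have "width_le norm \<delta> zs" using zs(3)[OF subnorm_norm ysw] by simp
    moreover have "fat T zs" using zs(4) unfolding fat_def by blast
    ultimately show "\<exists>ys. tiling T ys \<and> subdivides ((C + 1) * D) xs ys \<and> width_le norm \<delta> ys \<and> fat T ys"
      using zs(1) by blast
  qed
qed

section \<open>The limit curve\<close>

lemma concat_nth_uniform:
  assumes "\<forall>zs \<in> set zss. length zs = M" "k < length zss" "l < M"
  shows "concat zss ! (k * M + l) = zss ! k ! l"
  using assms
proof (induction zss arbitrary: k)
  case (Cons zs zss)
  then show ?case by (cases k) (auto simp: nth_append)
qed simp

lemma length_concat_uniform:
  assumes "\<forall>zs \<in> set zss. length zs = M"
  shows "length (concat zss) = length zss * M"
  using assms by (induction zss) auto

text \<open>Repeating the last piece gives every tile the same number \<open>M\<close> of pieces, so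
  that the parent of index \<open>k\<close> is \<open>k div M\<close> and the pieces match equal
  subintervals of time. Repetitions do not alter the blocks.\<close>

lemma subdivides_uniform:
  assumes "subdivides r xs ys" "xs \<noteq> []" "tiling T ys"
  obtains M zs where "M \<ge> 2" "length zs = length xs * M" "tiling T zs" "set zs = set ys"
    "\<And>k y. k < length zs \<Longrightarrow> y \<in> zs ! k \<Longrightarrow> \<exists>x \<in> xs ! (k div M). dist x y \<le> r"
    "\<And>k. k < length xs \<Longrightarrow> xs ! k \<subseteq> (\<Union>l<M. zs ! (k * M + l))"
proof -
  obtain yss where yss: "list_all2 (near_cover r) xs yss" "ys = concat yss"
    using assms(1) unfolding subdivides_def by blast
  have len: "length yss = length xs" using yss(1) by (simp add: list_all2_lengthD)
  have ch: "near_cover r (xs ! k) (yss ! k)" if "k < length xs" for k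
    using yss(1) that by (simp add: list_all2_conv_all_nth)
  have ne: "\<forall>ys \<in> set yss. ys \<noteq> []"
    using ch len by (auto simp: in_set_conv_nth near_cover_def)
  \<comment> \<open>No group of pieces is longer than this, and the successor makes it at least 2,
    so that the time cells shrink geometrically.\<close>
  define M where "M = Suc (length (concat yss))"
  define pad where "pad = (\<lambda>ys :: 'a set list. ys @ replicate (M - length ys) (last ys))"
  have lenM: "length zs \<le> M" if "zs \<in> set yss" for zs
    using that unfolding M_def length_concat
    by (intro le_SucI member_le_sum_list) auto
  have set_pad: "set (pad zs) = set zs" if "zs \<in> set yss" for zs
    using ne that by (auto simp: pad_def)
  have len_pad: "\<forall>zs \<in> set (map pad yss). length zs = M"
    using lenM by (auto simp: pad_def)
  define zs where "zs = concat (map pad yss)"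
  have len_zs: "length zs = length xs * M"
    unfolding zs_def using length_concat_uniform[OF len_pad] len by simp
  have nth: "zs ! (k * M + l) = pad (yss ! k) ! l" if "k < length xs" "l < M" for k l
    unfolding zs_def using concat_nth_uniform[OF len_pad, of k l] that len by simp
  have set_zs: "set zs = set ys"
    unfolding zs_def yss(2) using set_pad by auto
  show thesis
  proof
    have "length yss \<noteq> 0" using assms(2) len by simp
    then have "concat yss \<noteq> []" using ne by (cases yss) auto
    then show "M \<ge> 2" by (simp add: M_def Suc_le_eq)
    show "length zs = length xs * M" by (rule len_zs)
    show "set zs = set ys" by (rule set_zs)
    have "block_equiv zs ys"
      unfolding zs_def yss(2) pad_def using ne by (rule block_equiv_concat_pad)
    then show "tiling T zs"
      using assms(3) set_zs unfolding tiling_def block_equiv_def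
      by (metis empty_set set_empty)
    show "\<exists>x \<in> xs ! (k div M). dist x y \<le> r" if k: "k < length zs" "y \<in> zs ! k" for k y
    proof -
      have "k div M < length xs" using k(1) len_zs by (simp add: less_mult_imp_div_less)
      moreover have "k mod M < M" by (simp add: M_def)
      ultimately have "zs ! k = pad (yss ! (k div M)) ! (k mod M)"
        using nth[of "k div M" "k mod M"] by simp
      moreover have "yss ! (k div M) \<in> set yss" using \<open>k div M < length xs\<close> len by simp
      moreover have "k mod M < length (pad (yss ! (k div M)))"
        using len_pad calculation(2) \<open>k mod M < M\<close> by simp
      ultimately have "zs ! k \<in> set (yss ! (k div M))" using set_pad nth_mem by metis
      then show ?thesis
        using ch[OF \<open>k div M < length xs\<close>] k(2) unfolding near_cover_def by blast
    qed
    show "xs ! k \<subseteq> (\<Union>l<M. zs ! (k * M + l))" if k: "k < length xs" for k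
    proof
      fix x assume "x \<in> xs ! k"
      then obtain Y where Y: "Y \<in> set (yss ! k)" "x \<in> Y" using ch[OF k] unfolding near_cover_def by blast
      have "yss ! k \<in> set yss" using k len by simp
      with Y(1) have "Y \<in> set (pad (yss ! k))" using set_pad by blast
      then obtain l where "l < length (pad (yss ! k))" "pad (yss ! k) ! l = Y"
        by (auto simp: in_set_conv_nth)
      moreover have "length (pad (yss ! k)) = M" using len_pad \<open>yss ! k \<in> set yss\<close> by simp
      ultimately have "l < M" "zs ! (k * M + l) = Y" using nth[OF k, of l] by auto
      then show "x \<in> (\<Union>l<M. zs ! (k * M + l))" using Y(2) by blast
    qed
  qed
qed

lemma convex_blocks_nth:
  assumes "convex_blocks xs" "i \<le> j" "j < length xs"
  shows "convex (\<Union>k\<in>{i..j}. xs ! k)"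
proof -
  have "[0..<length xs] = [0..<i] @ [i..<Suc j] @ [Suc j..<length xs]"
  proof -
    obtain l where l: "Suc j = i + l" using assms(2) by (metis le_SucI le_Suc_ex)
    obtain m where m: "length xs = Suc j + m" using assms(3) by (metis Suc_leI le_Suc_ex)
    have "[0..<Suc j + m] = [0..<Suc j] @ [Suc j..<Suc j + m]" by (rule upt_add_eq_append) simp
    moreover have "[0..<i + l] = [0..<i] @ [i..<i + l]" by (rule upt_add_eq_append) simp
    ultimately show ?thesis unfolding m l by (simp only: append_assoc)
  qed
  then have "xs = map ((!) xs) [0..<i] @ map ((!) xs) [i..<Suc j] @ map ((!) xs) [Suc j..<length xs]"
    by (metis map_append map_nth)
  then have "convex (\<Union> (set (map ((!) xs) [i..<Suc j])))"
    using assms(1) unfolding convex_blocks_def by blast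
  moreover have "set [i..<Suc j] = {i..j}" by auto
  ultimately show ?thesis by (simp only: set_map)
qed

lemma adjacent_tiles_meet:
  assumes "tiling T xs" "Suc i < length xs"
  shows "xs ! i \<inter> xs ! Suc i \<noteq> {}"
proof -
  have "{i..Suc i} = {i, Suc i}" by auto
  then have "convex (xs ! i \<union> xs ! Suc i)"
    using convex_blocks_nth[of xs i "Suc i"] assms by (simp add: tiling_def)
  then have "connected (xs ! i \<union> xs ! Suc i)" by (rule convex_connected)
  moreover have "xs ! i \<in> set xs" "xs ! Suc i \<in> set xs" using assms(2) by auto
  then have "closed (xs ! i)" "closed (xs ! Suc i)" "xs ! i \<noteq> {}" "xs ! Suc i \<noteq> {}"
    using assms(1) unfolding tiling_def by blast+
  ultimately show ?thesis unfolding connected_closed by blast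
qed

section \<open>Uniform limits and cells of time\<close>

lemma geometric_limit:
  fixes x :: "nat \<Rightarrow> 'a::complete_space"
  assumes step: "\<And>n. dist (x (Suc n)) (x n) \<le> E / 2 ^ n"
  shows "\<exists>l. \<forall>n. dist (x n) l \<le> 2 * E / 2 ^ n"
proof -
  have E: "E \<ge> 0" using order_trans[OF zero_le_dist step[of 0]] by simp
  \<comment> \<open>The subtracted tail of the geometric series lets the induction close; it is
    dropped afterwards.\<close>
  have far: "dist (x n) (x (n + m)) \<le> 2 * E / 2 ^ n - 2 * E / 2 ^ (n + m)" for n m
  proof (induction m)
    case (Suc m)
    have "dist (x n) (x (n + Suc m)) \<le> dist (x n) (x (n + m)) + dist (x (n + m)) (x (Suc (n + m)))"
      using dist_triangle by simp
    also have "\<dots> \<le> 2 * E / 2 ^ n - 2 * E / 2 ^ (n + m) + E / 2 ^ (n + m)"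
      using Suc step[of "n + m"] by (simp add: dist_commute)
    also have "\<dots> = 2 * E / 2 ^ n - 2 * E / 2 ^ (n + Suc m)" by simp
    finally show ?case .
  qed simp
  have far': "dist (x n) (x m) \<le> 2 * E / 2 ^ n" if "n \<le> m" for n m
  proof -
    have "0 \<le> 2 * E / 2 ^ m" using E by simp
    then show ?thesis using far[of n "m - n"] that by simp
  qed
  have lim0: "(\<lambda>n. 2 * E / 2 ^ n) \<longlonglongrightarrow> 0"
    using tendsto_mult_right_zero[OF LIMSEQ_inverse_realpow_zero[of 2], of "2 * E"]
    by (simp add: divide_inverse)
  have "Cauchy x"
  proof (rule metric_CauchyI)
    fix e :: real assume "e > 0"
    then have "\<forall>\<^sub>F n in sequentially. 2 * E / 2 ^ n < e / 2"
      using order_tendstoD(2)[OF lim0, of "e / 2"] by simp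
    then obtain n where n: "2 * E / 2 ^ n < e / 2" by (auto simp: eventually_sequentially)
    have "dist (x i) (x j) < e" if "i \<ge> n" "j \<ge> n" for i j
      using dist_triangle3[of "x i" "x j" "x n"] far'[OF that(1)] far'[OF that(2)] n by simp
    then show "\<exists>n. \<forall>i\<ge>n. \<forall>j\<ge>n. dist (x i) (x j) < e" by blast
  qed
  then obtain l where l: "x \<longlonglongrightarrow> l" using Cauchy_convergent convergent_def by blast
  have "dist (x n) l \<le> 2 * E / 2 ^ n" for n
    by (rule LIMSEQ_le_const2[OF tendsto_dist[OF tendsto_const l]]) (use far' in blast)
  then show ?thesis by blast
qed

text \<open>Time \<open>t\<close> lies in cell \<open>k\<close> of \<open>N\<close> if \<open>k < t N \<le> k + 1\<close>; truncated subtraction puts time \<open>0\<close> into cell \<open>0\<close>.\<close>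

definition cell :: "nat \<Rightarrow> real \<Rightarrow> nat" where
  "cell N t = nat \<lceil>t * real N\<rceil> - 1"

lemma cell_less: "N > 0 \<Longrightarrow> t \<le> 1 \<Longrightarrow> cell N t < N"
proof -
  assume *: "N > 0" "t \<le> 1"
  have "t * real N \<le> 1 * real N" using * by (intro mult_right_mono) auto
  then have "\<lceil>t * real N\<rceil> \<le> int N" by (simp only: ceiling_le_iff mult_1 of_int_of_nat_eq)
  then have "nat \<lceil>t * real N\<rceil> \<le> N" by (simp only: nat_le_iff)
  then show "cell N t < N" using *(1) unfolding cell_def by linarith
qed

lemma cell_mono: "s \<le> t \<Longrightarrow> cell N s \<le> cell N t"
  unfolding cell_def by (intro diff_le_mono nat_mono ceiling_mono mult_right_mono) auto

lemma cell_bounds: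
  assumes "N > 0" "t \<ge> 0"
  shows "real (cell N t) / real N \<le> t" "t \<le> real (Suc (cell N t)) / real N"
proof -
  define c where "c = \<lceil>t * real N\<rceil>"
  have c: "of_int c - 1 < t * real N" "t * real N \<le> of_int c" unfolding c_def by linarith+
  have "0 \<le> t * real N" using assms by simp
  then have c0: "c \<ge> 0" using c(2) by linarith
  have "real (nat c - 1) \<le> t * real N" "t * real N \<le> real (Suc (nat c - 1))"
  proof -
    show "real (nat c - 1) \<le> t * real N"
    proof (cases "c = 0")
      case False
      then have "real (nat c - 1) = of_int c - 1" using c0 by (simp add: of_nat_diff)
      then show ?thesis using c by simp
    qed (use assms in simp)
    have "of_int c \<le> real (Suc (nat c - 1))" using c0 by linarith
    then show "t * real N \<le> real (Suc (nat c - 1))" using c by linarith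
  qed
  then show "real (cell N t) / real N \<le> t" "t \<le> real (Suc (cell N t)) / real N"
    using assms(1) unfolding cell_def c_def by (simp_all add: field_simps)
qed

lemma cell_right_end: "N > 0 \<Longrightarrow> cell N (real (Suc k) / real N) = k"
proof -
  assume "N > 0"
  then have "real (Suc k) / real N * real N = real_of_int (int (Suc k))" by simp
  then have "\<lceil>real (Suc k) / real N * real N\<rceil> = int (Suc k)" by (simp only: ceiling_of_int)
  then show ?thesis unfolding cell_def by simp
qed

text \<open>For the ceilings \<open>q\<close> of \<open>a\<close> and \<open>u\<close> of
  \<open>a * real M\<close> one has \<open>(q - 1) * M \<le> u - 1 < q * M\<close>, so the cells
  nest exactly. Time 0 is separate because its ceiling is not positive.\<close>

lemma cell_div:
  assumes "N > 0" "M > 0" "t \<ge> 0"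
  shows "cell (N * M) t div M = cell N t"
proof (cases "t = 0")
  case False
  define a where "a = t * real N"
  have a: "a > 0" using assms False by (simp add: a_def)
  define q where "q = \<lceil>a\<rceil>"
  define u where "u = \<lceil>a * real M\<rceil>"
  have q: "of_int q - 1 < a" "a \<le> of_int q" unfolding q_def by linarith+
  have u: "of_int u - 1 < a * real M" "a * real M \<le> of_int u" unfolding u_def by linarith+
  have q1: "q \<ge> 1" using a q by linarith
  have u1: "u \<ge> 1" using a u assms(2) by (smt (verit) mult_pos_pos of_int_le_0_iff of_nat_0_less_iff)
  have "real_of_int ((q - 1) * int M) < real_of_int u"
  proof -
    have "(of_int q - 1) * real M < a * real M" using q assms(2) by (intro mult_strict_right_mono) auto
    then show ?thesis using u by simp
  qed
  then have 1: "(q - 1) * int M \<le> u - 1" by linarith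
  have "real_of_int (u - 1) < real_of_int (q * int M)"
  proof -
    have "a * real M \<le> of_int q * real M" using q by (intro mult_right_mono) auto
    then show ?thesis using u by simp
  qed
  then have 2: "u - 1 < q * int M" by linarith
  have "(nat u - 1) div M = nat q - 1"
  proof (rule div_nat_eqI)
    have "int ((nat q - 1) * M) \<le> int (nat u - 1)" using 1 q1 u1 by (simp add: of_nat_diff)
    then show "M * (nat q - 1) \<le> nat u - 1" by (simp only: of_nat_le_iff mult.commute)
    have "int (nat u - 1) < int (nat q * M)" using 2 q1 u1 by (simp add: of_nat_diff)
    then have "nat u - 1 < nat q * M" by (simp only: of_nat_less_iff)
    moreover have "Suc (nat q - 1) = nat q" using q1 by simp
    ultimately show "nat u - 1 < M * Suc (nat q - 1)" by (simp add: mult.commute)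
  qed
  then show ?thesis unfolding cell_def u_def q_def a_def by (simp add: mult.assoc)
qed (simp add: cell_def)

lemma cell_near:
  assumes "N > 0" "0 \<le> s" "s \<le> t" "t - s < 1 / real N"
  shows "cell N t \<le> Suc (cell N s)"
proof -
  have "real (cell N t) / real N \<le> t" "s \<le> real (Suc (cell N s)) / real N"
    using cell_bounds assms by auto
  then have "real (cell N t) / real N < real (Suc (cell N s)) / real N + 1 / real N"
    using assms(4) by linarith
  then have "real (cell N t) < real (Suc (cell N s)) + 1"
    using assms(1) by (simp add: field_simps)
  then show ?thesis by linarith
qed


section \<open>The sequence of refinements and its limit\<close>

lemma tiling_sequence:
  fixes T :: "'a::euclidean_space set"
  assumes T: "convex T" "closed T" "bounded T" "T \<noteq> {}"
  obtains L :: "nat \<Rightarrow> 'a set list" and M :: "nat \<Rightarrow> nat" and C D :: real where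
    "C \<ge> 1" "D > 0" "L 0 = [T]" "\<And>n. tiling T (L n)" "\<And>n. width_le norm (D / 2 ^ n) (L n)"
    "\<And>n. fat T (L n)" "\<And>n. M n \<ge> 2" "\<And>n. length (L (Suc n)) = length (L n) * M n"
    "\<And>n k y. k < length (L (Suc n)) \<Longrightarrow> y \<in> L (Suc n) ! k \<Longrightarrow>
       \<exists>x \<in> L n ! (k div M n). dist x y \<le> C * D / 2 ^ n"
    "\<And>n k. k < length (L n) \<Longrightarrow> L n ! k \<subseteq> (\<Union>l<M n. L (Suc n) ! (k * M n + l))"
proof -
  obtain C where C: "C \<ge> 1" "\<And>xs D \<delta>. tiling T xs \<Longrightarrow> width_le norm D xs \<Longrightarrow> 0 < \<delta> \<Longrightarrow> \<delta> \<le> D \<Longrightarrow>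
    \<exists>ys. tiling T ys \<and> subdivides (C * D) xs ys \<and> width_le norm \<delta> ys \<and> fat T ys"
    by (rule fine_tiling[OF T(1-3)]) (rule that)
  obtain R where R: "R > 0" "\<And>x. x \<in> T \<Longrightarrow> norm x \<le> R" using T(3) by (auto simp: bounded_pos)
  define D where "D = 2 * R"
  \<comment> \<open>Dependent choice starts from some list satisfying \<open>P 0\<close>; the last
    clause forces it to be \<open>[T]\<close>, from which surjectivity follows in the end.\<close>
  define P where "P n xs \<longleftrightarrow> tiling T xs \<and> width_le norm (D / 2 ^ n) xs \<and> fat T xs \<and> (n = 0 \<longrightarrow> xs = [T])"
    for n xs
  define Q where "Q n xs ys \<longleftrightarrow> (\<exists>M \<ge> 2. length ys = length xs * M \<and>
      (\<forall>k y. k < length ys \<longrightarrow> y \<in> ys ! k \<longrightarrow> (\<exists>x \<in> xs ! (k div M). dist x y \<le> C * D / 2 ^ n)) \<and>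
      (\<forall>k < length xs. xs ! k \<subseteq> (\<Union>l<M. ys ! (k * M + l))))" for n and xs ys :: "'a set list"
  have "P 0 [T]"
  proof -
    have "convex_blocks [T]"
      using T(1) by (auto simp: convex_blocks_Cons prefix_unions_Cons)
    moreover have "norm (x - y) \<le> D" if "x \<in> T" "y \<in> T" for x y
      using norm_triangle_ineq4[of x y] R(2)[OF that(1)] R(2)[OF that(2)] by (simp add: D_def)
    moreover have "fat T [T]"
      using T(4) by (auto simp: fat_def intro: exI[of _ "1::real"])
    ultimately show ?thesis using T by (simp add: P_def tiling_def width_le_def)
  qed
  then have "\<exists>xs. P 0 xs" ..
  moreover have "\<exists>ys. P (Suc n) ys \<and> Q n xs ys" if "P n xs" for n xs
  proof -
    have xs: "tiling T xs" "width_le norm (D / 2 ^ n) xs" using that by (auto simp: P_def)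
    \<comment> \<open>The diameter bound is halved. The displacement is \<open>C\<close> times the
      current bound, with the same \<open>C\<close> at every stage, hence summable.\<close>
    have "0 < D / 2 ^ Suc n" "D / 2 ^ Suc n \<le> D / 2 ^ n" using R by (auto simp: D_def field_simps)
    from C(2)[OF xs this] obtain ys where ys: "tiling T ys" "subdivides (C * (D / 2 ^ n)) xs ys"
      "width_le norm (D / 2 ^ Suc n) ys" "fat T ys" by blast
    have "xs \<noteq> []" using xs by (simp add: tiling_def)
    obtain M zs where zs: "M \<ge> 2" "length zs = length xs * M" "tiling T zs" "set zs = set ys"
      "\<And>k y. k < length zs \<Longrightarrow> y \<in> zs ! k \<Longrightarrow> \<exists>x \<in> xs ! (k div M). dist x y \<le> C * (D / 2 ^ n)"
      "\<And>k. k < length xs \<Longrightarrow> xs ! k \<subseteq> (\<Union>l<M. zs ! (k * M + l))"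
      by (rule subdivides_uniform[OF ys(2) \<open>xs \<noteq> []\<close> ys(1)]) (rule that)
    have "P (Suc n) zs" using ys zs(3,4) by (simp add: P_def width_le_def fat_def)
    moreover have "Q n xs zs"
      unfolding Q_def using zs(5) by (intro exI[of _ M] conjI zs(1,2) allI impI zs(6)) simp_all
    ultimately show ?thesis by blast
  qed
  ultimately obtain L where L: "\<And>n. P n (L n)" "\<And>n. Q n (L n) (L (Suc n))"
    using dependent_nat_choice[of P Q] by blast
  have "\<forall>n. \<exists>M \<ge> 2. length (L (Suc n)) = length (L n) * M \<and>
      (\<forall>k y. k < length (L (Suc n)) \<longrightarrow> y \<in> L (Suc n) ! k \<longrightarrow>
         (\<exists>x \<in> L n ! (k div M). dist x y \<le> C * D / 2 ^ n)) \<and>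
      (\<forall>k < length (L n). L n ! k \<subseteq> (\<Union>l<M. L (Suc n) ! (k * M + l)))"
    using L(2) unfolding Q_def by blast
  then obtain M where M: "\<And>n. M n \<ge> 2 \<and> length (L (Suc n)) = length (L n) * M n \<and>
      (\<forall>k y. k < length (L (Suc n)) \<longrightarrow> y \<in> L (Suc n) ! k \<longrightarrow>
         (\<exists>x \<in> L n ! (k div M n). dist x y \<le> C * D / 2 ^ n)) \<and>
      (\<forall>k < length (L n). L n ! k \<subseteq> (\<Union>l<M n. L (Suc n) ! (k * M n + l)))"
    by metis
  show thesis
  proof (rule that[of C D L M])
    show "C \<ge> 1" "D > 0" using C R by (auto simp: D_def)
    show "L 0 = [T]" "tiling T (L n)" "width_le norm (D / 2 ^ n) (L n)" "fat T (L n)" for n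
      using L(1) unfolding P_def by blast+
    show "M n \<ge> 2" "length (L (Suc n)) = length (L n) * M n" for n using M[of n] by blast+
    show "\<exists>x \<in> L n ! (k div M n). dist x y \<le> C * D / 2 ^ n"
      if "k < length (L (Suc n))" "y \<in> L (Suc n) ! k" for n k y
      using M[of n] that by blast
    show "L n ! k \<subseteq> (\<Union>l<M n. L (Suc n) ! (k * M n + l))" if "k < length (L n)" for n k
      using M[of n] that by blast
  qed
qed

text \<open>The interior of a convex set, if non-empty, is dense in the set, so it meets the ball
  around \<open>y\<close>.\<close>

lemma interior_ball_Int_convex:
  fixes T :: "'a::euclidean_space set"
  assumes "convex T" "interior T \<noteq> {}" "y \<in> T" "r > 0"
  shows "interior (ball y r \<inter> T) \<noteq> {}"
proof -
  have "y \<in> closure (interior T)"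
    using assms convex_closure_interior[of T] closure_subset by blast
  then obtain w where "w \<in> interior T" "dist w y < r"
    using assms(4) unfolding closure_approachable by blast
  then have "w \<in> interior (ball y r \<inter> T)"
    by (simp add: interior_Int dist_commute)
  then show ?thesis by blast
qed

text \<open>The value at \<open>t\<close> is the limit of points from the tiles whose cells contain
  \<open>t\<close>. Images of closed intervals are compact, so approximate statements about them
  become exact: they inherit convexity from the block unions, and the image of a closed cell
  contains its tile.\<close>

theorem convex_filling_curve:
  fixes T :: "'a::euclidean_space set"
  assumes T: "convex T" "closed T" "bounded T" "T \<noteq> {}"
  obtains f :: "real \<Rightarrow> 'a" where "continuous_on {0..1} f" "f ` {0..1} = T"
    "\<And>I. is_interval I \<Longrightarrow> I \<subseteq> {0..1} \<Longrightarrow> convex (f ` I)"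
    "\<And>I. interior T \<noteq> {} \<Longrightarrow> is_interval I \<Longrightarrow> I \<subseteq> {0..1} \<Longrightarrow> \<exists>a\<in>I. \<exists>b\<in>I. a \<noteq> b \<Longrightarrow>
       interior (f ` I) \<noteq> {}"
proof -
  obtain L :: "nat \<Rightarrow> 'a set list" and M :: "nat \<Rightarrow> nat" and C D :: real where
    C: "C \<ge> 1" and D: "D > 0" and L0: "L 0 = [T]" and tiles: "\<And>n. tiling T (L n)"
    and width: "\<And>n. width_le norm (D / 2 ^ n) (L n)"
    and fat: "\<And>n. fat T (L n)" and M: "\<And>n. M n \<ge> 2"
    and len: "\<And>n. length (L (Suc n)) = length (L n) * M n"
    and parent: "\<And>n k y. k < length (L (Suc n)) \<Longrightarrow> y \<in> L (Suc n) ! k \<Longrightarrow>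
       \<exists>x \<in> L n ! (k div M n). dist x y \<le> C * D / 2 ^ n"
    and children: "\<And>n k. k < length (L n) \<Longrightarrow> L n ! k \<subseteq> (\<Union>l<M n. L (Suc n) ! (k * M n + l))"
    by (rule tiling_sequence[OF T]) (rule that)
  define N where "N n = length (L n)" for n
  have N0: "N 0 = 1" by (simp add: N_def L0)
  have NSuc: "N (Suc n) = N n * M n" for n by (simp add: N_def len)
  have Npow: "2 ^ n \<le> N n" for n
  proof (induction n)
    case (Suc n)
    then have "2 ^ n * 2 \<le> N n * M n" using M by (intro mult_mono) auto
    then show ?case by (simp add: NSuc mult.commute)
  qed (simp add: N0)
  have Npos: "N n > 0" for n using Npow[of n] by (metis not_gr_zero le_zero_eq power_not_zero zero_neq_numeral)
  define idx where "idx n t = cell (N n) t" for n t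
  have idx_less: "idx n t < N n" if "t \<in> {0..1}" for n t
    using cell_less[OF Npos] that by (simp add: idx_def)
  have idx_Suc: "idx n t = idx (Suc n) t div M n" if "t \<in> {0..1}" for n t
  proof -
    have "M n > 0" using M[of n] by simp
    then show ?thesis using cell_div[OF Npos[of n]] that by (simp add: idx_def NSuc)
  qed
  have tile: "closed (L n ! k)" "L n ! k \<noteq> {}" "L n ! k \<subseteq> T"
    "\<And>x y. x \<in> L n ! k \<Longrightarrow> y \<in> L n ! k \<Longrightarrow> dist x y \<le> D / 2 ^ n" if "k < N n" for n k
  proof -
    have mem: "L n ! k \<in> set (L n)" using that by (simp add: N_def)
    then show "closed (L n ! k)" "L n ! k \<noteq> {}" "L n ! k \<subseteq> T"
      using tiles[of n] unfolding tiling_def by blast+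
    show "dist x y \<le> D / 2 ^ n" if "x \<in> L n ! k" "y \<in> L n ! k" for x y
      using width[of n, unfolded width_le_def, rule_format, OF mem that] by (simp add: dist_norm)
  qed
  \<comment> \<open>Any choice will do: two points of the tile differ by at most its diameter, which
    tends to zero.\<close>
  define p where "p n t = (SOME x. x \<in> L n ! idx n t)" for n t
  have p: "p n t \<in> L n ! idx n t" if "t \<in> {0..1}" for n t
    unfolding p_def using tile(2)[OF idx_less[OF that]] by (simp add: some_in_eq)
  \<comment> \<open>One refinement moves a point by at most \<open>C * D / 2 ^ n\<close> to the
    parent tile and by the diameter \<open>D / 2 ^ n\<close> within it.\<close>
  define E where "E = (C + 1) * D"
  have E: "E > 0" "D \<le> E" using C D by (simp_all add: E_def)
  have step: "dist (p (Suc n) t) (p n t) \<le> E / 2 ^ n" if t: "t \<in> {0..1}" for n t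
  proof -
    have "idx (Suc n) t < length (L (Suc n))" using idx_less[OF t] by (simp add: N_def)
    from parent[OF this p[OF t], folded idx_Suc[OF t]] obtain x where x: "x \<in> L n ! idx n t"
      "dist x (p (Suc n) t) \<le> C * D / 2 ^ n" by blast
    have "dist x (p n t) \<le> D / 2 ^ n" using tile(4)[OF idx_less[OF t] x(1) p[OF t]] .
    then have "dist (p (Suc n) t) (p n t) \<le> C * D / 2 ^ n + D / 2 ^ n"
      using dist_triangle3[of "p (Suc n) t" "p n t" x] x(2) by linarith
    then show ?thesis by (simp add: E_def algebra_simps add_divide_distrib)
  qed
  have "\<forall>t \<in> {0..1}. \<exists>l. \<forall>n. dist (p n t) l \<le> 2 * E / 2 ^ n"
    using step by (intro ballI geometric_limit)
  then obtain f where f: "\<And>t n. t \<in> {0..1} \<Longrightarrow> dist (p n t) (f t) \<le> 2 * E / 2 ^ n"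
    by metis
  \<comment> \<open>This is \<open>2 * E / 2 ^ n\<close> for the distance to the limit and
    \<open>E / 2 ^ n\<close> for the diameter of the tile.\<close>
  define e where "e n = 3 * E / 2 ^ n" for n
  have e_small: "\<exists>n\<ge>m. e n < \<epsilon>" if "\<epsilon> > 0" for \<epsilon> m
  proof -
    have "(\<lambda>n. 3 * E / 2 ^ n) \<longlonglongrightarrow> 0"
      using tendsto_mult_right_zero[OF LIMSEQ_inverse_realpow_zero[of 2], of "3 * E"]
      by (simp add: divide_inverse)
    then have "\<forall>\<^sub>F n in sequentially. e n < \<epsilon>"
      unfolding e_def using that by (rule order_tendstoD(2))
    then have "\<forall>\<^sub>F n in sequentially. n \<ge> m \<and> e n < \<epsilon>"
      using eventually_ge_at_top[of m] by eventually_elim simp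
    then show ?thesis using eventually_happens by fastforce
  qed
  have near: "dist (f t) z \<le> e n" if t: "t \<in> {0..1}" and z: "z \<in> L n ! idx n t" for n t z
  proof -
    have "dist (p n t) z \<le> D / 2 ^ n" using tile(4)[OF idx_less[OF t] p[OF t] z] .
    also have "\<dots> \<le> E / 2 ^ n" using E by (simp add: divide_right_mono)
    finally have "dist (f t) z \<le> 2 * E / 2 ^ n + E / 2 ^ n"
      using f[OF t, of n] dist_triangle3[of "f t" z "p n t"] by linarith
    then show ?thesis by (simp add: e_def add_divide_distrib[symmetric])
  qed
  \<comment> \<open>Times closer than a cell length lie in the same or in adjacent cells, whose
    tiles share a point near both values.\<close>
  have close: "dist (f s) (f t) \<le> 2 * e n" if st: "s \<in> {0..1}" "t \<in> {0..1}" "s \<le> t" "t - s < 1 / real (N n)" for s t n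
  proof -
    have "idx n t \<le> Suc (idx n s)" "idx n s \<le> idx n t"
      using cell_near[OF Npos, of s t n] cell_mono st by (auto simp: idx_def)
    then have "idx n t = idx n s \<or> idx n t = Suc (idx n s)" by linarith
    then have "L n ! idx n s \<inter> L n ! idx n t \<noteq> {}"
      using tile(2)[OF idx_less[OF st(1)], of n] adjacent_tiles_meet[OF tiles[of n], of "idx n s"]
        idx_less[OF st(2), of n] by (auto simp: N_def)
    then obtain z where "z \<in> L n ! idx n s" "z \<in> L n ! idx n t" by blast
    then show ?thesis
      using near[OF st(1)] near[OF st(2)] dist_triangle2[of "f s" "f t" z] by fastforce
  qed
  have cont: "continuous_on {0..1} f"
    unfolding continuous_on_iff
  proof (intro ballI allI impI)
    fix s \<epsilon> :: real assume s: "s \<in> {0..1}" "\<epsilon> > 0"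
    obtain n where n: "e n < \<epsilon> / 2" using e_small[of "\<epsilon> / 2" 0] s by auto
    show "\<exists>d>0. \<forall>t\<in>{0..1}. dist t s < d \<longrightarrow> dist (f t) (f s) < \<epsilon>"
    proof (intro exI[of _ "1 / real (N n)"] conjI ballI impI)
      show "0 < 1 / real (N n)" using Npos by simp
      fix t :: real assume t: "t \<in> {0..1}" "dist t s < 1 / real (N n)"
      have "dist (f t) (f s) \<le> 2 * e n"
      proof (cases "s \<le> t")
        case True
        then show ?thesis using close[of s t n] s t by (simp add: dist_real_def dist_commute)
      next
        case False
        then show ?thesis using close[of t s n] s t by (simp add: dist_real_def)
      qed
      then show "dist (f t) (f s) < \<epsilon>" using n by simp
    qed
  qed
  have closed_im: "closed (f ` {a..b})" if "0 \<le> a" "b \<le> 1" for a b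
  proof -
    have "continuous_on {a..b} f" using cont that by (rule_tac continuous_on_subset) auto
    then show ?thesis by (intro compact_imp_closed compact_continuous_image) auto
  qed
  \<comment> \<open>At level \<open>n\<close> the combination of the chosen points lies in a convex
    block union, hence in one tile between the cells of \<open>s\<close> and \<open>t\<close>. The
    value of \<open>f\<close> at a time in that cell is near the combination.\<close>
  have segment: "u *\<^sub>R f s + v *\<^sub>R f t \<in> f ` {s..t}"
    if st: "s \<in> {0..1}" "t \<in> {0..1}" "s \<le> t" and uv: "u \<ge> 0" "v \<ge> 0" "u + v = 1" for s t u v
  proof -
    let ?z = "u *\<^sub>R f s + v *\<^sub>R f t"
    have "\<exists>y \<in> f ` {s..t}. dist y ?z < \<epsilon>" if \<epsilon>: "\<epsilon> > 0" for \<epsilon>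
    proof -
      obtain n where n: "e n < \<epsilon> / 2" using e_small[of "\<epsilon> / 2" 0] \<epsilon> by auto
      let ?w = "u *\<^sub>R p n s + v *\<^sub>R p n t"
      have le: "idx n s \<le> idx n t" using cell_mono st by (simp add: idx_def)
      have "convex (\<Union>k\<in>{idx n s..idx n t}. L n ! k)"
        using tiles[of n] le idx_less[OF st(2), of n] unfolding N_def tiling_def
        by (intro convex_blocks_nth) auto
      moreover have "p n s \<in> (\<Union>k\<in>{idx n s..idx n t}. L n ! k)" "p n t \<in> (\<Union>k\<in>{idx n s..idx n t}. L n ! k)"
      proof -
        have "idx n s \<in> {idx n s..idx n t}" "idx n t \<in> {idx n s..idx n t}" using le by auto
        then show "p n s \<in> (\<Union>k\<in>{idx n s..idx n t}. L n ! k)" "p n t \<in> (\<Union>k\<in>{idx n s..idx n t}. L n ! k)"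
          using p[OF st(1), of n] p[OF st(2), of n] by blast+
      qed
      ultimately have "?w \<in> (\<Union>k\<in>{idx n s..idx n t}. L n ! k)"
        using uv by (rule convexD)
      then obtain k where k: "idx n s \<le> k" "k \<le> idx n t" "?w \<in> L n ! k" by auto
      \<comment> \<open>The right end of a cell belongs to the cell. For the last cell it may exceed
        \<open>t\<close>, and then \<open>t\<close> itself serves.\<close>
      have "\<exists>\<tau> \<in> {s..t}. idx n \<tau> = k"
      proof (cases "k = idx n t")
        case True
        then show ?thesis using st by (intro bexI[of _ t]) auto
      next
        case False
        have "s \<le> real (Suc (idx n s)) / real (N n)"
          using cell_bounds(2)[OF Npos] st by (simp add: idx_def)
        also have "\<dots> \<le> real (Suc k) / real (N n)" using k(1) by (intro divide_right_mono) auto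
        finally have 1: "s \<le> real (Suc k) / real (N n)" .
        have "real (Suc k) / real (N n) \<le> real (idx n t) / real (N n)"
          using k(2) False by (intro divide_right_mono) auto
        also have "\<dots> \<le> t" using cell_bounds(1)[OF Npos] st by (simp add: idx_def)
        finally have "real (Suc k) / real (N n) \<in> {s..t}" using 1 by simp
        then show ?thesis
          by (rule bexI[rotated]) (simp add: idx_def cell_right_end[OF Npos] del: of_nat_Suc)
      qed
      then obtain \<tau> where \<tau>: "\<tau> \<in> {s..t}" "idx n \<tau> = k" by blast
      then have "\<tau> \<in> {0..1}" using st by auto
      then have "dist (f \<tau>) ?w \<le> e n" using near[of \<tau> ?w n] \<tau> k by simp
      moreover have "dist ?w ?z \<le> e n"
      proof -
        have "?w - ?z = u *\<^sub>R (p n s - f s) + v *\<^sub>R (p n t - f t)" by (simp add: algebra_simps)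
        then have "dist ?w ?z \<le> u * dist (p n s) (f s) + v * dist (p n t) (f t)"
          using norm_triangle_ineq[of "u *\<^sub>R (p n s - f s)" "v *\<^sub>R (p n t - f t)"] uv
          by (simp add: dist_norm)
        also have "\<dots> \<le> u * (2 * E / 2 ^ n) + v * (2 * E / 2 ^ n)"
          using f[OF st(1)] f[OF st(2)] uv by (intro add_mono mult_left_mono) auto
        also have "\<dots> = (u + v) * (2 * E / 2 ^ n)" by (rule distrib_right[symmetric])
        also have "\<dots> \<le> e n" using uv E by (simp add: e_def divide_right_mono)
        finally show ?thesis .
      qed
      ultimately have "dist (f \<tau>) ?z < \<epsilon>" using dist_triangle[of "f \<tau>" ?z ?w] n by linarith
      then show ?thesis using \<tau>(1) by blast
    qed
    moreover have "closed (f ` {s..t})" using closed_im st by simp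
    ultimately show ?thesis using closed_approachable by blast
  qed
  \<comment> \<open>At each level the point is passed on to one of the pieces of its tile. The time
    moves to the right end of the corresponding subcell, which keeps all coarser indices.\<close>
  have descend: "\<exists>t \<in> {0..1}. idx n t = k \<and> z \<in> L m ! idx m t" if "z \<in> L n ! k" "k < N n" "n \<le> m" for n k z m
    using that(3)
  proof (induction rule: dec_induct)
    case base
    have "real (Suc k) \<le> real (N n)" using that(2) by simp
    then have "real (Suc k) / real (N n) \<in> {0..1}" by (simp add: divide_le_eq_1)
    moreover have "idx n (real (Suc k) / real (N n)) = k"
      unfolding idx_def by (rule cell_right_end[OF Npos])
    ultimately show ?case using that(1) by metis
  next
    case (step m)
    then obtain t where t: "t \<in> {0..1}" "idx n t = k" "z \<in> L m ! idx m t" by blast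
    have "idx m t < length (L m)" using idx_less[OF t(1)] by (simp add: N_def)
    from children[OF this] t(3) obtain l where l: "l < M m" "z \<in> L (Suc m) ! (idx m t * M m + l)" by blast
    define j where "j = idx m t * M m + l"
    define t' where "t' = real (Suc j) / real (N (Suc m))"
    have "Suc j \<le> Suc (idx m t) * M m" using l(1) by (simp add: j_def)
    also have "\<dots> \<le> N m * M m" using idx_less[OF t(1), of m] by (intro mult_right_mono) auto
    finally have "real (Suc j) \<le> real (N (Suc m))" unfolding NSuc by (simp only: of_nat_le_iff)
    then have t': "t' \<in> {0..1}" by (simp add: t'_def divide_le_eq_1)
    have j': "idx (Suc m) t' = j" unfolding idx_def t'_def by (rule cell_right_end[OF Npos])
    have "idx m t' = j div M m" using idx_Suc[OF t', of m] j' by simp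
    then have same: "idx m t' = idx m t" using l(1) by (simp add: j_def)
    have "idx n' t' = idx n' t" if "n' \<le> m" for n'
      using that
    proof (induction rule: inc_induct)
      case (step i)
      then show ?case using idx_Suc[OF t', of i] idx_Suc[OF t(1), of i] by simp
    qed (rule same)
    then have "idx n t' = k" using t(2) step.hyps by simp
    moreover have "z \<in> L (Suc m) ! idx (Suc m) t'" using l(2) unfolding j' j_def .
    ultimately show ?case using t' by (intro bexI[of _ t'] conjI)
  qed
  \<comment> \<open>\<open>descend\<close> finds \<open>z\<close> in tiles of arbitrarily deep
    levels at times inside cell \<open>k\<close>, so \<open>z\<close> is a limit of values
    there.\<close>
  have cover: "L n ! k \<subseteq> f ` {real k / real (N n)..real (Suc k) / real (N n)}" if k: "k < N n" for n k
  proof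
    fix z assume z: "z \<in> L n ! k"
    let ?I = "{real k / real (N n)..real (Suc k) / real (N n)}"
    have "\<exists>y \<in> f ` ?I. dist y z < \<epsilon>" if \<epsilon>: "\<epsilon> > 0" for \<epsilon>
    proof -
      obtain m where m: "n \<le> m" "e m < \<epsilon>" using e_small[OF \<epsilon>] by blast
      obtain t where t: "t \<in> {0..1}" "idx n t = k" "z \<in> L m ! idx m t"
        using descend[OF z k m(1)] by blast
      have "t \<in> ?I" using cell_bounds[OF Npos[of n], of t] t(1,2) by (simp add: idx_def)
      moreover have "dist (f t) z < \<epsilon>" using near[OF t(1,3)] m(2) by simp
      ultimately show ?thesis by blast
    qed
    moreover have "closed (f ` ?I)"
    proof (rule closed_im)
      have "real (Suc k) \<le> real (N n)" using k by simp
      then show "real (Suc k) / real (N n) \<le> 1" by (simp add: divide_le_eq_1)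
    qed simp
    ultimately show "z \<in> f ` ?I" using closed_approachable by blast
  qed
  have image: "f ` {0..1} = T"
  proof
    show "T \<subseteq> f ` {0..1}" using cover[of 0 0] by (simp add: N0 L0)
    show "f ` {0..1} \<subseteq> T"
    proof
      fix x assume "x \<in> f ` {0..1}"
      then obtain t where t: "t \<in> {0..1}" "x = f t" by (elim imageE) (rule that)
      have "\<exists>y \<in> T. dist y x < \<epsilon>" if \<epsilon>: "\<epsilon> > 0" for \<epsilon>
      proof -
        obtain n where n: "e n < \<epsilon>" using e_small[OF \<epsilon>, of 0] by blast
        have "p n t \<in> T" using p[OF t(1)] tile(3)[OF idx_less[OF t(1)]] by blast
        moreover have "dist (p n t) x < \<epsilon>"
          using near[OF t(1) p[OF t(1)], of n] n t(2) by (simp add: dist_commute)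
        ultimately show ?thesis by blast
      qed
      then show "x \<in> T" using T(2) closed_approachable by blast
    qed
  qed
  have conv: "convex (f ` I)" if I: "is_interval I" "I \<subseteq> {0..1}" for I
  proof (rule convexI)
    fix x y and u v :: real
    assume xy: "x \<in> f ` I" "y \<in> f ` I" and uv: "0 \<le> u" "0 \<le> v" "u + v = 1"
    from xy obtain s t where st: "s \<in> I" "t \<in> I" "x = f s" "y = f t" by blast
    \<comment> \<open>This reduces an interval of any kind to the closed intervals treated by
      \<open>segment\<close>.\<close>
    have sub: "{a..b} \<subseteq> I" if "a \<in> I" "b \<in> I" for a b
      using I(1) that unfolding is_interval_1 by (meson atLeastAtMost_iff subsetI)
    have unit: "s \<in> {0..1}" "t \<in> {0..1}" using st I(2) by auto
    show "u *\<^sub>R x + v *\<^sub>R y \<in> f ` I"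
    proof (cases "s \<le> t")
      case True
      then show ?thesis
        using segment[OF unit True uv] sub[OF st(1,2)] image_mono unfolding st(3,4) by blast
    next
      case False
      then have "v *\<^sub>R y + u *\<^sub>R x \<in> f ` {t..s}"
        using segment[OF unit(2,1) _ uv(2,1)] uv(3) unfolding st(3,4) by (simp add: add.commute)
      then show ?thesis using sub[OF st(2,1)] image_mono by (metis add.commute subsetD)
    qed
  qed
  have inter: "interior (f ` I) \<noteq> {}"
    if T': "interior T \<noteq> {}" and I: "is_interval I" "I \<subseteq> {0..1}" "\<exists>a\<in>I. \<exists>b\<in>I. a \<noteq> b" for I
  proof -
    obtain a b where ab: "a \<in> I" "b \<in> I" "a < b" using I(3) by (metis linorder_neqE)
    \<comment> \<open>The level is so fine that \<open>{a..b}\<close> is longer than two cells; then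
      the first cell starting at or after \<open>a\<close> ends by \<open>b\<close>.\<close>
    obtain n where "2 / (b - a) < 2 ^ n" using real_arch_pow[of 2 "2 / (b - a)"] by auto
    also have "(2::real) ^ n \<le> real (N n)" using Npow[of n] by (metis of_nat_le_iff of_nat_numeral of_nat_power)
    finally have Nn: "2 < (b - a) * real (N n)" using ab(3) by (simp add: field_simps)
    define k where "k = nat \<lceil>a * real (N n)\<rceil>"
    have a0: "0 \<le> a" "b \<le> 1" using ab I(2) by auto
    have "0 \<le> a * real (N n)" using a0 by simp
    then have k: "a * real (N n) \<le> real k" "real k < a * real (N n) + 1"
      unfolding k_def by linarith+
    have "real (Suc k) \<le> b * real (N n)" using k(2) Nn by (simp add: algebra_simps)
    moreover have "b * real (N n) \<le> 1 * real (N n)" using a0 by (intro mult_right_mono) auto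
    ultimately have kN: "k < N n" by simp
    have "a \<le> real k / real (N n)" using k(1) Npos[of n] by (simp add: pos_le_divide_eq)
    moreover have "real (Suc k) / real (N n) \<le> b"
      using \<open>real (Suc k) \<le> b * real (N n)\<close> Npos[of n] by (simp add: pos_divide_le_eq)
    ultimately have "{real k / real (N n)..real (Suc k) / real (N n)} \<subseteq> I"
      using I(1) ab(1,2) unfolding is_interval_1 by (meson atLeastAtMost_iff order_trans subsetI)
    then have sub: "L n ! k \<subseteq> f ` I" using cover[OF kN] by blast
    have "L n ! k \<in> set (L n)" using kN by (simp add: N_def)
    then obtain y r where y: "y \<in> L n ! k" "r > 0" "ball y r \<inter> T \<subseteq> L n ! k"
      using fat[of n] unfolding fat_def by blast
    have "y \<in> T" using y(1) tile(3)[OF kN] by blast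
    then have "interior (ball y r \<inter> T) \<noteq> {}" using T(1) T' y(2) by (intro interior_ball_Int_convex)
    moreover have "interior (ball y r \<inter> T) \<subseteq> interior (f ` I)"
      using y(3) sub by (intro interior_mono) blast
    ultimately show ?thesis by blast
  qed
  show thesis using that[OF cont image conv inter] .
qed

theorem theoremA:
  fixes T :: "(real ^ 2) set"
  assumes "T \<noteq> {}" and "convex T" and "closed T" and "bounded T"
  shows "(\<exists>f. convex_Peano_curve T f) \<and>
    (interior T \<noteq> {} \<longrightarrow>
      (\<exists>f. convex_Peano_curve T f \<and>
        (\<forall>I. is_interval I \<and> I \<subseteq> {0..1} \<and> (\<exists>a\<in>I. \<exists>b\<in>I. a \<noteq> b) \<longrightarrow>
          interior (f ` I) \<noteq> {})))"
proof -
  obtain f :: "real \<Rightarrow> real ^ 2" where f: "continuous_on {0..1} f" "f ` {0..1} = T"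
    "\<And>I. is_interval I \<Longrightarrow> I \<subseteq> {0..1} \<Longrightarrow> convex (f ` I)"
    "\<And>I. interior T \<noteq> {} \<Longrightarrow> is_interval I \<Longrightarrow> I \<subseteq> {0..1} \<Longrightarrow> \<exists>a\<in>I. \<exists>b\<in>I. a \<noteq> b \<Longrightarrow>
       interior (f ` I) \<noteq> {}"
    by (rule convex_filling_curve[OF assms(2-4) assms(1)]) (rule that)
  have "convex_Peano_curve T f" using f unfolding convex_Peano_curve_def by simp
  then show ?thesis using f(4) by blast
qed

end
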